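(* Let $\mathcal{S}\subseteq\mathbb{R}^3$ be a $C^2$ surface, with the induced Riemannian metric. Then: (i) $\mathcal{S}$ is minimal if and only if $\mathcal{S}$ has an atlas of isothermal normally $\infty$-Harmonic parametrizations. (ii) $\mathcal{S}$ is locally isometric to $(\mathbb{R}^2,c^2I)$ for some $c\in\mathbb{R}$ if and only if $\mathcal{S}$ has an atlas of isothermal tangentially $\infty$-Harmonic parametrizations. (iii) $\mathcal{S}$ is contained in an affine plane of $\mathbb{R}^3$ if and only if $\mathcal{S}$ has an atlas of isothermal $\infty$-Harmonic parametrizations.
   Context: For a map $u:\Omega\subseteq\mathbb{R}^2\to\mathbb{R}^3$ ($\Omega$ open) of class $C^2$, $Du(x)\in\mathbb{R}^{3\times2}$ is the gradient matrix with entries $D_iu_\alpha$, $|Du|$ is its Euclidean (Frobenius) norm, $[Du(x)]^\bot$ is the orthogonal projection of $\mathbb{R}^3$ onto the nullspace of $Du(x)^\top$, and $\Delta u$ is the componentwise Laplacian. Then $u$ is called: - tangentially $\infty$-Harmonic if $Du\otimes Du:D^2u=0$ on $\Omega$, i.e. $D_iu_\alpha D_ju_\beta D^2_{ij}u_\beta=0$ for each $\alpha$ (summing over $i,j,\beta$); - normally $\infty$-Harmonic if $|Du|^2[Du]^\bot\Delta u=0$ on $\Omega$; - $\infty$-Harmonic if $Du\otimes Du:D^2u+|Du|^2[Du]^\bot\Delta u=0$ on $\Omega$. An isothermal parametrization of (a piece of) $\mathcal{S}$ is a local parametrization $u:\Omega\subseteq\mathbb{R}^2\to\mathcal{S}$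 which is a conformal immersion, i.e. $Du^\top Du=f^2I$ on $\Omega$ for some $f\in C^1(\Omega)$ with $f\neq0$ on $\Omega$. An atlas is a family of such parametrizations whose images cover $\mathcal{S}$. $\mathcal{S}$ is minimal if its mean curvature vanishes identically. $(\mathbb{R}^2,c^2I)$ denotes $\mathbb{R}^2$ with the constant metric equal to $c^2$ times the Euclidean one.
   Formalization: In (iii) the surface S is additionally assumed connected; without this (iii) fails, e.g. for two disjoint open discs lying in two different planes, which have an atlas of isothermal ∞-Harmonic parametrizations but lie in no common plane. *)

theory Defs
  imports "HOL-Analysis.Analysis"
begin

definition pd :: "'n::finite \<Rightarrow> (real^'n \<Rightarrow> 'b::real_normed_vector) \<Rightarrow> real^'n \<Rightarrow> 'b"
  where "pd i f x = frechet_derivative f (at x) (axis i 1)"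

definition C1_on :: "(real^'n::finite) set \<Rightarrow> (real^'n \<Rightarrow> 'b::real_normed_vector) \<Rightarrow> bool"
  where "C1_on \<Omega> f \<longleftrightarrow> (\<forall>x\<in>\<Omega>. f differentiable (at x)) \<and> (\<forall>i. continuous_on \<Omega> (pd i f))"

definition C2_on :: "(real^'n::finite) set \<Rightarrow> (real^'n \<Rightarrow> 'b::real_normed_vector) \<Rightarrow> bool"
  where "C2_on \<Omega> f \<longleftrightarrow> C1_on \<Omega> f \<and> (\<forall>i. C1_on \<Omega> (pd i f))"

text \<open>The gradient matrix: row \<open>\<alpha>\<close>, column \<open>i\<close> holds the \<open>i\<close>-th partial derivative of the
  \<open>\<alpha>\<close>-th component. The library norm on such matrices is the Frobenius norm.\<close>

abbreviation grad :: "(real^'n::finite \<Rightarrow> real^'m::finite) \<Rightarrow> real^'n \<Rightarrow> real^'n^'m"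
  where "grad u x \<equiv> jacobian u (at x)"

definition laplacian :: "(real^'n::finite \<Rightarrow> 'b::real_normed_vector) \<Rightarrow> real^'n \<Rightarrow> 'b"
  where "laplacian u x = (\<Sum>i\<in>UNIV. pd i (pd i u) x)"

definition orth_proj :: "(real^'n::finite) set \<Rightarrow> real^'n \<Rightarrow> real^'n"
  where "orth_proj N v = (THE w. w \<in> N \<and> (\<forall>z\<in>N. orthogonal (v - w) z))"

definition grad_perp :: "(real^2 \<Rightarrow> real^3) \<Rightarrow> real^2 \<Rightarrow> real^3 \<Rightarrow> real^3"
  where "grad_perp u x = orth_proj {v. transpose (grad u x) *v v = 0}"

definition tang_op :: "(real^2 \<Rightarrow> real^3) \<Rightarrow> real^2 \<Rightarrow> real^3"
  where "tang_op u x = (\<chi> \<alpha>. \<Sum>i\<in>UNIV. \<Sum>j\<in>UNIV. \<Sum>\<beta>\<in>UNIV.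
           grad u x $ \<alpha> $ i * grad u x $ \<beta> $ j * pd i (pd j u) x $ \<beta>)"

definition norm_op :: "(real^2 \<Rightarrow> real^3) \<Rightarrow> real^2 \<Rightarrow> real^3"
  where "norm_op u x = (norm (grad u x))\<^sup>2 *\<^sub>R grad_perp u x (laplacian u x)"

definition tang_inf_harmonic :: "(real^2) set \<Rightarrow> (real^2 \<Rightarrow> real^3) \<Rightarrow> bool"
  where "tang_inf_harmonic \<Omega> u \<longleftrightarrow> open \<Omega> \<and> C2_on \<Omega> u \<and> (\<forall>x\<in>\<Omega>. tang_op u x = 0)"

definition norm_inf_harmonic :: "(real^2) set \<Rightarrow> (real^2 \<Rightarrow> real^3) \<Rightarrow> bool"
  where "norm_inf_harmonic \<Omega> u \<longleftrightarrow> open \<Omega> \<and> C2_on \<Omega> u \<and> (\<forall>x\<in>\<Omega>. norm_op u x = 0)"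

definition inf_harmonic :: "(real^2) set \<Rightarrow> (real^2 \<Rightarrow> real^3) \<Rightarrow> bool"
  where "inf_harmonic \<Omega> u \<longleftrightarrow> open \<Omega> \<and> C2_on \<Omega> u \<and> (\<forall>x\<in>\<Omega>. tang_op u x + norm_op u x = 0)"

text \<open>Surfaces are embedded: a local parametrization is a \<open>C\<^sup>2\<close> immersion which is a homeomorphism
  onto a relatively open subset of the surface.\<close>

definition local_param :: "(real^3) set \<Rightarrow> (real^2) set \<Rightarrow> (real^2 \<Rightarrow> real^3) \<Rightarrow> bool"
  where "local_param S \<Omega> u \<longleftrightarrow> open \<Omega> \<and> C2_on \<Omega> u \<and>
           openin (top_of_set S) (u ` \<Omega>) \<and> (\<exists>v. homeomorphism \<Omega> (u ` \<Omega>) u v) \<and>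
           (\<forall>x\<in>\<Omega>. rank (grad u x) = 2)"

definition C2_surface :: "(real^3) set \<Rightarrow> bool"
  where "C2_surface S \<longleftrightarrow> (\<forall>p\<in>S. \<exists>\<Omega> u. local_param S \<Omega> u \<and> p \<in> u ` \<Omega>)"

definition isothermal_param :: "(real^3) set \<Rightarrow> (real^2) set \<Rightarrow> (real^2 \<Rightarrow> real^3) \<Rightarrow> bool"
  where "isothermal_param S \<Omega> u \<longleftrightarrow> local_param S \<Omega> u \<and>
           (\<exists>f::real^2 \<Rightarrow> real. C1_on \<Omega> f \<and> (\<forall>x\<in>\<Omega>. f x \<noteq> 0) \<and>
              (\<forall>x\<in>\<Omega>. transpose (grad u x) ** grad u x = mat ((f x)\<^sup>2)))"

definition has_isothermal_atlas ::
    "(real^3) set \<Rightarrow> ((real^2) set \<Rightarrow> (real^2 \<Rightarrow> real^3) \<Rightarrow> bool) \<Rightarrow> bool"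
  where "has_isothermal_atlas S P \<longleftrightarrow>
           (\<exists>\<A>. (\<forall>(\<Omega>, u)\<in>\<A>. isothermal_param S \<Omega> u \<and> P \<Omega> u) \<and> (\<Union>(\<Omega>, u)\<in>\<A>. u ` \<Omega>) = S)"

definition unit_normal :: "(real^2 \<Rightarrow> real^3) \<Rightarrow> real^2 \<Rightarrow> real^3"
  where "unit_normal u x = sgn (cross3 (pd 1 u x) (pd 2 u x))"

definition first_fund :: "(real^2 \<Rightarrow> real^3) \<Rightarrow> real^2 \<Rightarrow> real^2^2"
  where "first_fund u x = (\<chi> i j. pd i u x \<bullet> pd j u x)"

definition second_fund :: "(real^2 \<Rightarrow> real^3) \<Rightarrow> real^2 \<Rightarrow> real^2^2"
  where "second_fund u x = (\<chi> i j. pd i (pd j u) x \<bullet> unit_normal u x)"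

text \<open>Half the trace of the shape operator, with respect to the normal induced by the
  parametrization. A change of parametrization can alter it only by a sign, so its vanishing is a
  property of the surface alone.\<close>

definition mean_curvature :: "(real^2 \<Rightarrow> real^3) \<Rightarrow> real^2 \<Rightarrow> real"
  where "mean_curvature u x = trace (matrix_inv (first_fund u x) ** second_fund u x) / 2"

definition minimal_surface :: "(real^3) set \<Rightarrow> bool"
  where "minimal_surface S \<longleftrightarrow>
           (\<forall>\<Omega> u. local_param S \<Omega> u \<longrightarrow> (\<forall>x\<in>\<Omega>. mean_curvature u x = 0))"

text \<open>A \<open>C\<^sup>2\<close> diffeomorphism \<open>\<phi>\<close> from the surface \<open>U\<close> onto the open set \<open>V\<close> that pulls the metric
  \<open>c\<^sup>2 I\<close> back to the induced metric of \<open>U\<close>. Tangent vectors of \<open>U\<close> at \<open>u x\<close> are written as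
  \<open>grad u x *v h\<close> in a parametrization \<open>u\<close>; the differential of \<open>\<phi>\<close> sends such a vector to
  \<open>grad (\<phi> \<circ> u) x *v h\<close>.\<close>

definition isometry_onto_plane_region ::
    "real \<Rightarrow> (real^3) set \<Rightarrow> (real^2) set \<Rightarrow> (real^3 \<Rightarrow> real^2) \<Rightarrow> bool"
  where "isometry_onto_plane_region c U V \<phi> \<longleftrightarrow>
           open V \<and> bij_betw \<phi> U V \<and> C2_on V (inv_into U \<phi>) \<and>
           (\<forall>\<Omega> u. local_param U \<Omega> u \<longrightarrow> C2_on \<Omega> (\<phi> \<circ> u) \<and>
              (\<forall>x\<in>\<Omega>. \<forall>h k. c\<^sup>2 * ((grad (\<phi> \<circ> u) x *v h) \<bullet> (grad (\<phi> \<circ> u) x *v k)) =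
                           (grad u x *v h) \<bullet> (grad u x *v k)))"

definition locally_isometric_to_plane :: "(real^3) set \<Rightarrow> real \<Rightarrow> bool"
  where "locally_isometric_to_plane S c \<longleftrightarrow>
           (\<forall>p\<in>S. \<exists>U V \<phi>. p \<in> U \<and> openin (top_of_set S) U \<and> isometry_onto_plane_region c U V \<phi>)"

end

theory Submission
  imports Defs "HOL-Complex_Analysis.Conformal_Mappings"
begin

text \<open>
  All three equivalences come from reading the two operators in an isothermal parametrization \<open>u\<close>
  with conformal factor \<open>f\<close>, so that the columns of \<open>Du\<close> are orthogonal of length \<open>\<bar>f\<bar>\<close>.
  Then the coefficients of the tangential operator along the columns of \<open>Du\<close> are the partial
  derivatives of \<open>f\<^sup>2\<close> (\<open>tang_op_conformal_factor\<close>), while the normal operator is a non-zero multiple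
  of \<open>(\<Delta>u \<bullet> n) n\<close>, where \<open>\<Delta>u \<bullet> n\<close> is \<open>2 f\<^sup>2\<close> times the mean curvature (\<open>mean_curvature_conformal\<close>). Hence
  tangentially harmonic means that \<open>f\<close> is locally constant, and normally harmonic means that the
  mean curvature vanishes.

  (i) It remains to produce isothermal coordinates on a minimal surface, and to transfer the vanishing of
  the mean curvature between parametrizations (\<open>minimal_surfaceI\<close>). For a parametrization \<open>w\<close>
  with unit normal \<open>n\<close>, the vector-valued form \<open>n \<times> dw\<close> is closed exactly when the mean curvature
  vanishes. So for a constant vector \<open>e\<close> the form \<open>e \<bullet> (n \<times> dw)\<close> has a local
  potential \<open>\<eta>\<close>, which is the harmonic conjugate of the height \<open>\<xi> = e \<bullet> w\<close>: the surface gradients of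
  \<open>\<xi>\<close> and \<open>\<eta>\<close> are the tangential part of \<open>e\<close> and its rotation by a right angle. Therefore
  \<open>(\<xi>, \<eta>)\<close> is a conformal map into the plane, a local diffeomorphism wherever \<open>e\<close> is not normal to the
  surface, and its inverse gives the isothermal parametrization
  (\<open>minimal_surface_isothermal_coordinates\<close>). The form is \<open>C\<^sup>1\<close>, so \<open>\<eta>\<close> is \<open>C\<^sup>2\<close> and no regularity
  is lost.

  (ii) The inverse of an isometry onto a region of \<open>(\<real>\<^sup>2, c\<^sup>2 I)\<close> is an isothermal parametrization
  with constant conformal factor (\<open>plane_isometry_inverse_isothermal\<close>). Conversely, where the factor is the
  constant \<open>l\<close>, the map \<open>l u\<^sup>-\<^sup>1\<close> is an isometry onto a region of the Euclidean plane
  (\<open>constant_factor_imp_isometry\<close>). The scaling makes \<open>c = 1\<close> work for all charts at once, although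
  \<open>l\<close> may differ from one chart to another. Since the definition of an isometry tests every
  parametrization, this needs that transition maps are \<open>C\<^sup>2\<close> (\<open>transition_map_C2\<close>).

  (iii) The tangential and normal parts are orthogonal, so an \<open>\<infinity>\<close>-Harmonic isothermal \<open>u\<close> has
  locally constant \<open>f\<close> and no normal part of \<open>\<Delta>u\<close>. The Laplacian of a conformal
  map with constant factor has no tangential part either, so \<open>u\<close> is harmonic and
  \<open>D\<^sub>1u - \<i> D\<^sub>2u\<close> is a holomorphic curve of constant norm. By the maximum modulus principle it is
  constant (\<open>harmonic_constant_speed_imp_constant_gradient\<close>), so \<open>u\<close> is affine near each point and \<open>S\<close> is
  locally an open piece of a plane. Overlapping pieces span the same plane, and connectedness of \<open>S\<close> makes
  that plane unique (\<open>flat_charts_imp_planar\<close>). Conversely, a surface inside a plane is open in it, by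
  invariance of domain, and Euclidean coordinates of the plane form the atlas.
\<close>

section \<open>Calculus with partial derivatives\<close>

lemma has_derivative_pd:
  fixes f :: "real^'n::finite \<Rightarrow> 'b::real_normed_vector"
  assumes "f differentiable (at x)"
  shows "(f has_derivative (\<lambda>h. \<Sum>i\<in>UNIV. (h $ i) *\<^sub>R pd i f x)) (at x)"
proof -
  let ?D = "frechet_derivative f (at x)"
  have D: "(f has_derivative ?D) (at x)"
    using assms by (simp add: frechet_derivative_works)
  then have lin: "linear ?D" by (rule has_derivative_linear)
  have "?D h = (\<Sum>i\<in>UNIV. (h $ i) *\<^sub>R pd i f x)" for h
  proof -
    have "?D h = ?D (\<Sum>i\<in>UNIV. (h $ i) *s axis i 1)"
      by (simp add: basis_expansion)
    also have "\<dots> = (\<Sum>i\<in>UNIV. (h $ i) *\<^sub>R ?D (axis i 1))"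
      by (simp add: linear_sum[OF lin] linear_scale[OF lin] scalar_mult_eq_scaleR)
    finally show ?thesis by (simp add: pd_def)
  qed
  then have "?D = (\<lambda>h. \<Sum>i\<in>UNIV. (h $ i) *\<^sub>R pd i f x)" by blast
  with D show ?thesis by simp
qed

lemma pd_eqI:
  assumes "(f has_derivative D) (at x)"
  shows "pd i f x = D (axis i 1)"
  unfolding pd_def using frechet_derivative_at[OF assms] by simp

lemma C1_on_has_derivative:
  assumes "C1_on \<Omega> f" "x \<in> \<Omega>"
  shows "(f has_derivative (\<lambda>h. \<Sum>i\<in>UNIV. (h $ i) *\<^sub>R pd i f x)) (at x)"
  using assms has_derivative_pd by (auto simp: C1_on_def)

lemma C1_on_continuous: "C1_on \<Omega> f \<Longrightarrow> continuous_on \<Omega> f"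
  by (meson C1_on_def continuous_at_imp_continuous_on differentiable_imp_continuous_within)

lemma C1_on_continuous_pd: "C1_on \<Omega> f \<Longrightarrow> continuous_on \<Omega> (pd i f)"
  by (simp add: C1_on_def)

lemma C2_on_imp_C1_on: "C2_on \<Omega> f \<Longrightarrow> C1_on \<Omega> f"
  by (simp add: C2_on_def)

lemma C2_on_C1_on_pd: "C2_on \<Omega> f \<Longrightarrow> C1_on \<Omega> (pd i f)"
  by (simp add: C2_on_def)

lemma C1_on_subset: "C1_on \<Omega> f \<Longrightarrow> \<Omega>' \<subseteq> \<Omega> \<Longrightarrow> C1_on \<Omega>' f"
  unfolding C1_on_def by (meson continuous_on_subset subsetD)

lemma C2_on_subset: "C2_on \<Omega> f \<Longrightarrow> \<Omega>' \<subseteq> \<Omega> \<Longrightarrow> C2_on \<Omega>' f"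
  unfolding C2_on_def by (meson C1_on_subset)

lemma C1_on_pointwise:
  assumes "\<And>x. x \<in> \<Omega> \<Longrightarrow> \<exists>U. open U \<and> x \<in> U \<and> C1_on U f"
  shows "C1_on \<Omega> f"
  unfolding C1_on_def
proof (intro conjI ballI allI)
  fix x assume "x \<in> \<Omega>"
  then show "f differentiable (at x)" using assms unfolding C1_on_def by blast
next
  fix i show "continuous_on \<Omega> (pd i f)"
  proof (rule continuous_at_imp_continuous_on, intro ballI)
    fix x assume "x \<in> \<Omega>"
    then obtain U where "open U" "x \<in> U" "C1_on U f" using assms by blast
    then show "isCont (pd i f) x"
      unfolding C1_on_def using continuous_on_eq_continuous_at by blast
  qed
qed

lemma C2_on_pointwise:
  assumes "\<And>x. x \<in> \<Omega> \<Longrightarrow> \<exists>U. open U \<and> x \<in> U \<and> C2_on U f"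
  shows "C2_on \<Omega> f"
  using assms unfolding C2_on_def by (meson C1_on_pointwise)

lemma pd_cong:
  assumes "open U" "x \<in> U" "\<And>y. y \<in> U \<Longrightarrow> f y = g y"
  shows "pd i f x = pd i g x"
proof -
  have "(f has_derivative D) (at x) \<longleftrightarrow> (g has_derivative D) (at x)" for D
    using assms has_derivative_transform_within_open[of _ D x UNIV U] by metis
  then show ?thesis by (simp add: pd_def frechet_derivative_def)
qed

lemma pd_pd_cong:
  assumes "open U" "x \<in> U" "\<And>y. y \<in> U \<Longrightarrow> f y = g y"
  shows "pd i (pd j f) x = pd i (pd j g) x"
  using assms by (intro pd_cong[of U]) (auto intro: pd_cong)

lemma C1_onI:
  assumes "open \<Omega>"
    and "\<And>x. x \<in> \<Omega> \<Longrightarrow> (f has_derivative (\<lambda>h. \<Sum>i\<in>UNIV. (h $ i) *\<^sub>R D i x)) (at x)"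
    and "\<And>i. continuous_on \<Omega> (D i)"
  shows "C1_on \<Omega> f" and "\<And>x i. x \<in> \<Omega> \<Longrightarrow> pd i f x = D i x"
proof -
  show *: "pd i f x = D i x" if "x \<in> \<Omega>" for x i
  proof -
    have "pd i f x = (\<Sum>j\<in>UNIV. (if j = i then D i x else 0))"
      unfolding pd_eqI[OF assms(2)[OF that]] by (rule sum.cong) (auto simp: axis_def)
    then show ?thesis by simp
  qed
  show "C1_on \<Omega> f"
    unfolding C1_on_def
  proof (intro conjI ballI allI)
    show "f differentiable (at x)" if "x \<in> \<Omega>" for x
      using assms(2)[OF that] differentiable_def by blast
    show "continuous_on \<Omega> (pd i f)" for i
      using assms(3)[of i] * by (simp cong: continuous_on_cong)
  qed
qed

lemma C1_on_cong:
  assumes "open \<Omega>" "C1_on \<Omega> g" "\<And>x. x \<in> \<Omega> \<Longrightarrow> f x = g x"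
  shows "C1_on \<Omega> f"
proof (rule C1_onI(1)[where D = "\<lambda>i. pd i g"])
  fix x assume "x \<in> \<Omega>"
  with C1_on_has_derivative[OF assms(2) this] assms
  show "(f has_derivative (\<lambda>h. \<Sum>i\<in>UNIV. (h $ i) *\<^sub>R pd i g x)) (at x)"
    using has_derivative_transform_within_open by (metis (no_types, lifting))
qed (use assms in \<open>auto intro: C1_on_continuous_pd\<close>)

text \<open>A function is proved to be \<open>C\<^sup>2\<close> by exhibiting its gradient as a \<open>C\<^sup>1\<close> field. This suits maps
  such as potentials and local inverses, whose derivative is known by a formula.\<close>

lemma C2_onI:
  assumes "open \<Omega>"
    and "\<And>x. x \<in> \<Omega> \<Longrightarrow> (f has_derivative (\<lambda>h. \<Sum>i\<in>UNIV. (h $ i) *\<^sub>R D i x)) (at x)"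
    and "\<And>i. C1_on \<Omega> (D i)"
  shows "C2_on \<Omega> f"
  unfolding C2_on_def
  using C1_onI[OF assms(1,2)] assms C1_on_continuous C1_on_cong by metis

lemma C2_on_cong:
  assumes "open \<Omega>" "C2_on \<Omega> g" "\<And>x. x \<in> \<Omega> \<Longrightarrow> f x = g x"
  shows "C2_on \<Omega> f"
  using assms pd_cong[of \<Omega> _ f g] C1_on_cong unfolding C2_on_def by metis

lemma pd_const [simp]: "pd i (\<lambda>x. c) = (\<lambda>x. 0)"
  by (rule ext) (simp add: pd_eqI[OF has_derivative_const])

lemma C1_on_const: "C1_on \<Omega> (\<lambda>x. c)"
  by (simp add: C1_on_def)

lemma pd_linear:
  assumes "bounded_linear L" "f differentiable (at x)"
  shows "pd i (\<lambda>x. L (f x)) x = L (pd i f x)"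
proof -
  interpret bounded_linear L by fact
  show ?thesis
    using pd_eqI[OF has_derivative[OF has_derivative_pd[OF assms(2)]]] pd_eqI[OF has_derivative_pd[OF assms(2)]]
    by metis
qed

lemma C1_on_linear:
  assumes "open \<Omega>" "bounded_linear L" "C1_on \<Omega> f"
  shows "C1_on \<Omega> (\<lambda>x. L (f x))"
proof -
  interpret bounded_linear L by fact
  show ?thesis
  proof (rule C1_onI(1)[OF assms(1), where D = "\<lambda>i x. L (pd i f x)"])
    fix x assume "x \<in> \<Omega>"
    from has_derivative[OF C1_on_has_derivative[OF assms(3) this]]
    show "((\<lambda>x. L (f x)) has_derivative (\<lambda>h. \<Sum>i\<in>UNIV. (h $ i) *\<^sub>R L (pd i f x))) (at x)"
      by (simp add: sum scaleR)
  next
    show "continuous_on \<Omega> (\<lambda>x. L (pd i f x))" for i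
      using continuous_on C1_on_continuous_pd assms by blast
  qed
qed

lemma C2_on_linear:
  assumes "open \<Omega>" "bounded_linear L" "C2_on \<Omega> f"
  shows "C2_on \<Omega> (\<lambda>x. L (f x))"
  unfolding C2_on_def
proof (intro conjI allI)
  show "C1_on \<Omega> (\<lambda>x. L (f x))" using assms C1_on_linear C2_on_def by blast
  fix i
  show "C1_on \<Omega> (pd i (\<lambda>x. L (f x)))"
    using C1_on_linear[OF assms(1,2) C2_on_C1_on_pd[OF assms(3), of i]]
    by (rule C1_on_cong[OF assms(1)])
      (use assms in \<open>auto intro!: pd_linear simp: C2_on_def C1_on_def\<close>)
qed

lemma pd_bilinear:
  assumes "bounded_bilinear B" "f differentiable (at x)" "g differentiable (at x)"
  shows "pd i (\<lambda>x. B (f x) (g x)) x = B (f x) (pd i g x) + B (pd i f x) (g x)"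
  using pd_eqI[OF bounded_bilinear.FDERIV[OF assms(1) has_derivative_pd[OF assms(2)] has_derivative_pd[OF assms(3)]]]
    pd_eqI[OF has_derivative_pd[OF assms(2)]] pd_eqI[OF has_derivative_pd[OF assms(3)]]
  by metis

lemma C1_on_bilinear:
  assumes "open \<Omega>" "bounded_bilinear B" "C1_on \<Omega> f" "C1_on \<Omega> g"
  shows "C1_on \<Omega> (\<lambda>x. B (f x) (g x))"
proof -
  interpret bounded_bilinear B by fact
  show ?thesis
  proof (rule C1_onI(1)[OF assms(1), where D = "\<lambda>i x. B (f x) (pd i g x) + B (pd i f x) (g x)"])
    fix x assume "x \<in> \<Omega>"
    then show "((\<lambda>x. B (f x) (g x)) has_derivative
        (\<lambda>h. \<Sum>i\<in>UNIV. (h $ i) *\<^sub>R (B (f x) (pd i g x) + B (pd i f x) (g x)))) (at x)"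
      using FDERIV[OF C1_on_has_derivative[OF assms(3)] C1_on_has_derivative[OF assms(4)]]
      by (simp add: sum_right sum_left scaleR_left scaleR_right scaleR_add_right sum.distrib)
  next
    show "continuous_on \<Omega> (\<lambda>x. B (f x) (pd i g x) + B (pd i f x) (g x))" for i
      using assms by (intro continuous_intros continuous_on C1_on_continuous_pd C1_on_continuous)
  qed
qed

lemma C1_on_add:
  assumes "open \<Omega>" "C1_on \<Omega> f" "C1_on \<Omega> g"
  shows "C1_on \<Omega> (\<lambda>x. f x + g x)"
proof (rule C1_onI(1)[OF assms(1), where D = "\<lambda>i x. pd i f x + pd i g x"])
  fix x assume "x \<in> \<Omega>"
  then show "((\<lambda>x. f x + g x) has_derivative
      (\<lambda>h. \<Sum>i\<in>UNIV. (h $ i) *\<^sub>R (pd i f x + pd i g x))) (at x)"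
    using has_derivative_add[OF C1_on_has_derivative[OF assms(2)] C1_on_has_derivative[OF assms(3)]]
    by (simp add: scaleR_add_right sum.distrib)
next
  show "continuous_on \<Omega> (\<lambda>x. pd i f x + pd i g x)" for i
    using assms by (intro continuous_intros C1_on_continuous_pd)
qed

lemma C1_on_uminus: "open \<Omega> \<Longrightarrow> C1_on \<Omega> f \<Longrightarrow> C1_on \<Omega> (\<lambda>x. - f x)"
  by (rule C1_on_linear[where L = uminus]) (auto intro: bounded_linear_minus bounded_linear_ident)

lemma C1_on_diff: "open \<Omega> \<Longrightarrow> C1_on \<Omega> f \<Longrightarrow> C1_on \<Omega> g \<Longrightarrow> C1_on \<Omega> (\<lambda>x. f x - g x)"
  using C1_on_add[of \<Omega> f "\<lambda>x. - g x"] C1_on_uminus[of \<Omega> g] by simp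

lemma C1_on_sum:
  assumes "open \<Omega>" "\<And>a. a \<in> A \<Longrightarrow> C1_on \<Omega> (f a)"
  shows "C1_on \<Omega> (\<lambda>x. \<Sum>a\<in>A. f a x)"
  using assms(2)
  by (induction A rule: infinite_finite_induct) (auto intro: C1_on_const C1_on_add assms(1))

lemma C1_on_nth: "open \<Omega> \<Longrightarrow> C1_on \<Omega> f \<Longrightarrow> C1_on \<Omega> (\<lambda>x. f x $ a)"
  by (rule C1_on_linear[OF _ bounded_linear_vec_nth])

lemma C1_on_scalar:
  fixes f :: "real^'n::finite \<Rightarrow> real"
  assumes "open \<Omega>" "C1_on \<Omega> f"
    and "\<And>x. x \<in> \<Omega> \<Longrightarrow> (\<phi> has_real_derivative \<phi>' (f x)) (at (f x))"
    and "continuous_on (f ` \<Omega>) \<phi>'"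
  shows "C1_on \<Omega> (\<lambda>x. \<phi> (f x))"
proof (rule C1_onI(1)[OF assms(1), where D = "\<lambda>i x. \<phi>' (f x) * pd i f x"])
  fix x assume "x \<in> \<Omega>"
  then show "((\<lambda>x. \<phi> (f x)) has_derivative
      (\<lambda>h. \<Sum>i\<in>UNIV. (h $ i) *\<^sub>R (\<phi>' (f x) * pd i f x))) (at x)"
    using has_derivative_compose[OF C1_on_has_derivative[OF assms(2)]
        has_field_derivative_imp_has_derivative[OF assms(3)]]
    by (simp add: sum_distrib_left mult_ac)
next
  show "continuous_on \<Omega> (\<lambda>x. \<phi>' (f x) * pd i f x)" for i
    using assms by (intro continuous_intros C1_on_continuous_pd C1_on_continuous
        continuous_on_compose2[OF assms(4)]) auto
qed

lemma has_derivative_chain_pd: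
  fixes g :: "real^'n::finite \<Rightarrow> real^'m::finite"
  assumes "g differentiable (at x)" "f differentiable (at (g x))"
  shows "((\<lambda>x. f (g x)) has_derivative
      (\<lambda>h. \<Sum>i\<in>UNIV. (h $ i) *\<^sub>R (\<Sum>a\<in>UNIV. pd i g x $ a *\<^sub>R pd a f (g x)))) (at x)"
proof -
  have "((\<lambda>x. f (g x)) has_derivative
     (\<lambda>h. \<Sum>a\<in>UNIV. ((\<Sum>i\<in>UNIV. (h $ i) *\<^sub>R pd i g x) $ a) *\<^sub>R pd a f (g x))) (at x)"
    by (rule has_derivative_compose[OF has_derivative_pd[OF assms(1)] has_derivative_pd[OF assms(2)]])
  moreover have "(\<Sum>a\<in>UNIV. ((\<Sum>i\<in>UNIV. (h $ i) *\<^sub>R pd i g x) $ a) *\<^sub>R pd a f (g x)) =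
      (\<Sum>i\<in>UNIV. (h $ i) *\<^sub>R (\<Sum>a\<in>UNIV. pd i g x $ a *\<^sub>R pd a f (g x)))" for h :: "real^'n"
    by (simp add: scaleR_sum_left scaleR_sum_right) (rule sum.swap)
  ultimately show ?thesis by simp
qed

lemma pd_chain:
  fixes g :: "real^'n::finite \<Rightarrow> real^'m::finite"
  assumes "g differentiable (at x)" "f differentiable (at (g x))"
  shows "pd i (\<lambda>x. f (g x)) x = (\<Sum>a\<in>UNIV. pd i g x $ a *\<^sub>R pd a f (g x))"
proof -
  have "pd i (\<lambda>x. f (g x)) x =
     (\<Sum>j\<in>UNIV. if j = i then (\<Sum>a\<in>UNIV. pd i g x $ a *\<^sub>R pd a f (g x)) else 0)"
    unfolding pd_eqI[OF has_derivative_chain_pd[OF assms]] by (rule sum.cong) (auto simp: axis_def)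
  then show ?thesis by simp
qed

lemma C1_on_compose:
  fixes g :: "real^'n::finite \<Rightarrow> real^'m::finite"
  assumes "open \<Omega>" "C1_on W f" "C1_on \<Omega> g" "g ` \<Omega> \<subseteq> W"
  shows "C1_on \<Omega> (\<lambda>x. f (g x))"
proof (rule C1_onI(1)[OF assms(1), where D = "\<lambda>i x. \<Sum>a\<in>UNIV. pd i g x $ a *\<^sub>R pd a f (g x)"])
  fix x assume "x \<in> \<Omega>"
  then show "((\<lambda>x. f (g x)) has_derivative
      (\<lambda>h. \<Sum>i\<in>UNIV. (h $ i) *\<^sub>R (\<Sum>a\<in>UNIV. pd i g x $ a *\<^sub>R pd a f (g x)))) (at x)"
    using assms by (intro has_derivative_chain_pd) (auto simp: C1_on_def)
next
  show "continuous_on \<Omega> (\<lambda>x. \<Sum>a\<in>UNIV. pd i g x $ a *\<^sub>R pd a f (g x))" for i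
    using assms by (intro continuous_intros continuous_on_compose2[OF C1_on_continuous_pd[OF assms(2)]]
      C1_on_continuous_pd C1_on_continuous) auto
qed

lemma C2_on_compose:
  fixes g :: "real^'n::finite \<Rightarrow> real^'m::finite"
  assumes "open \<Omega>" "C2_on W f" "C2_on \<Omega> g" "g ` \<Omega> \<subseteq> W"
  shows "C2_on \<Omega> (\<lambda>x. f (g x))"
proof (rule C2_onI[OF assms(1), where D = "\<lambda>i x. \<Sum>a\<in>UNIV. pd i g x $ a *\<^sub>R pd a f (g x)"])
  fix x assume "x \<in> \<Omega>"
  then show "((\<lambda>x. f (g x)) has_derivative
      (\<lambda>h. \<Sum>i\<in>UNIV. (h $ i) *\<^sub>R (\<Sum>a\<in>UNIV. pd i g x $ a *\<^sub>R pd a f (g x)))) (at x)"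
    using assms by (intro has_derivative_chain_pd) (auto simp: C1_on_def C2_on_def)
next
  show "C1_on \<Omega> (\<lambda>x. \<Sum>a\<in>UNIV. pd i g x $ a *\<^sub>R pd a f (g x))" for i
    by (intro C1_on_sum C1_on_bilinear[OF _ bounded_bilinear_scaleR] C1_on_nth C2_on_C1_on_pd
        C1_on_compose[OF _ C2_on_C1_on_pd[OF assms(2)]] C2_on_imp_C1_on assms)
qed

lemma C2_on_ident:
  assumes "open \<Omega>"
  shows "C2_on \<Omega> (\<lambda>x. x :: real^'n::finite)"
proof (rule C2_onI[OF assms, where D = "\<lambda>i x. axis i 1"])
  show "((\<lambda>x. x) has_derivative (\<lambda>h. \<Sum>i\<in>UNIV. (h $ i) *\<^sub>R axis i 1)) (at x)" for x :: "real^'n"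
    using has_derivative_ident by (simp add: basis_expansion flip: scalar_mult_eq_scaleR)
qed (rule C1_on_const)

section \<open>Symmetry of second partial derivatives, and potentials of closed forms\<close>

lemma DERIV_along_axis:
  fixes f :: "real^'n::finite \<Rightarrow> real"
  assumes "f differentiable (at (a + s *\<^sub>R axis i 1))"
  shows "((\<lambda>s. f (a + s *\<^sub>R axis i 1)) has_real_derivative pd i f (a + s *\<^sub>R axis i 1)) (at s)"
proof -
  have g: "((\<lambda>s. a + s *\<^sub>R axis i 1) has_derivative (\<lambda>t. t *\<^sub>R axis i 1)) (at s)"
    by (auto intro!: derivative_eq_intros)
  have D: "(f has_derivative frechet_derivative f (at (a + s *\<^sub>R axis i 1))) (at (a + s *\<^sub>R axis i 1))"
    using assms by (simp add: frechet_derivative_works)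
  have "((\<lambda>s. f (a + s *\<^sub>R axis i 1)) has_derivative
      (\<lambda>t. frechet_derivative f (at (a + s *\<^sub>R axis i 1)) (t *\<^sub>R axis i 1))) (at s)"
    by (rule has_derivative_compose[OF g D])
  then show ?thesis
    by (simp add: has_field_derivative_def pd_def mult.commute[of _ "frechet_derivative f _ _"]
        linear_scale[OF has_derivative_linear[OF D]] mult_commute_abs)
qed

text \<open>Two applications of the mean value theorem, first in direction \<open>i\<close> and then in direction \<open>j\<close>. The
  left-hand side is symmetric in \<open>i\<close> and \<open>j\<close>, so letting \<open>h\<close> tend to \<open>0\<close> shows that second
  partial derivatives commute.\<close>

lemma second_difference_eq:
  fixes f :: "real^'n::finite \<Rightarrow> real"
  assumes C2: "C2_on (ball x r) f" and h: "0 < h" "2 * h < r"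
  shows "\<exists>p. dist x p \<le> 2 * h \<and>
    f (x + h *\<^sub>R axis i 1 + h *\<^sub>R axis j 1) - f (x + h *\<^sub>R axis i 1) - f (x + h *\<^sub>R axis j 1) + f x =
      h\<^sup>2 * pd j (pd i f) p"
proof -
  let ?i = "axis i 1 :: real^'n" and ?j = "axis j 1 :: real^'n"
  have dist: "dist x (x + s *\<^sub>R ?i + t *\<^sub>R ?j) \<le> 2 * h" if "0 \<le> s" "s \<le> h" "0 \<le> t" "t \<le> h" for s t
  proof -
    have "dist x (x + s *\<^sub>R ?i + t *\<^sub>R ?j) = norm (s *\<^sub>R ?i + t *\<^sub>R ?j)"
      using norm_minus_cancel[of "s *\<^sub>R ?i + t *\<^sub>R ?j"] by (simp add: dist_norm)
    also have "\<dots> \<le> norm (s *\<^sub>R ?i) + norm (t *\<^sub>R ?j)" by (rule norm_triangle_ineq)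
    also have "\<dots> \<le> 2 * h" using that by (simp add: norm_axis_1)
    finally show ?thesis .
  qed
  then have inball: "x + s *\<^sub>R ?i + t *\<^sub>R ?j \<in> ball x r" if "0 \<le> s" "s \<le> h" "0 \<le> t" "t \<le> h" for s t
    using order.strict_trans1[OF dist[OF that] h(2)] by simp
  have df: "f differentiable (at y)" "pd i f differentiable (at y)" if "y \<in> ball x r" for y
    using C2 that by (auto simp: C2_on_def C1_on_def)
  define g where "g s = f (x + h *\<^sub>R ?j + s *\<^sub>R ?i) - f (x + s *\<^sub>R ?i)" for s
  have "\<exists>s. 0 < s \<and> s < h \<and>
      g h - g 0 = (h - 0) * (pd i f (x + h *\<^sub>R ?j + s *\<^sub>R ?i) - pd i f (x + s *\<^sub>R ?i))"
  proof (rule MVT2[OF h(1)])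
    fix s assume "0 \<le> s" "s \<le> h"
    then have "x + h *\<^sub>R ?j + s *\<^sub>R ?i \<in> ball x r" "x + s *\<^sub>R ?i \<in> ball x r"
      using inball[of s h] inball[of s 0] h by (auto simp: add_ac)
    then show "(g has_real_derivative pd i f (x + h *\<^sub>R ?j + s *\<^sub>R ?i) - pd i f (x + s *\<^sub>R ?i)) (at s)"
      unfolding g_def by (intro DERIV_diff[OF DERIV_along_axis DERIV_along_axis] df)
  qed
  then obtain s where s: "0 < s" "s < h"
    and gs: "g h - g 0 = h * (pd i f (x + s *\<^sub>R ?i + h *\<^sub>R ?j) - pd i f (x + s *\<^sub>R ?i))"
    by (auto simp: add_ac)
  have "\<exists>t. 0 < t \<and> t < h \<and>
      pd i f (x + s *\<^sub>R ?i + h *\<^sub>R ?j) - pd i f (x + s *\<^sub>R ?i + 0 *\<^sub>R ?j) =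
      (h - 0) * pd j (pd i f) (x + s *\<^sub>R ?i + t *\<^sub>R ?j)"
  proof (rule MVT2[OF h(1)])
    fix t assume "0 \<le> t" "t \<le> h"
    then show "((\<lambda>t. pd i f (x + s *\<^sub>R ?i + t *\<^sub>R ?j)) has_real_derivative
        pd j (pd i f) (x + s *\<^sub>R ?i + t *\<^sub>R ?j)) (at t)"
      using s inball[of s t] by (intro DERIV_along_axis df) auto
  qed
  then obtain t where t: "0 < t" "t < h"
    and "pd i f (x + s *\<^sub>R ?i + h *\<^sub>R ?j) - pd i f (x + s *\<^sub>R ?i) = h * pd j (pd i f) (x + s *\<^sub>R ?i + t *\<^sub>R ?j)"
    by auto
  with gs have "g h - g 0 = h\<^sup>2 * pd j (pd i f) (x + s *\<^sub>R ?i + t *\<^sub>R ?j)"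
    by (simp add: power2_eq_square)
  moreover have "dist x (x + s *\<^sub>R ?i + t *\<^sub>R ?j) \<le> 2 * h" using dist s t by simp
  ultimately show ?thesis
    unfolding g_def by (intro exI[of _ "x + s *\<^sub>R ?i + t *\<^sub>R ?j"]) (simp add: algebra_simps)
qed

lemma pd_commute_real:
  fixes f :: "real^'n::finite \<Rightarrow> real"
  assumes C2: "C2_on \<Omega> f" and "open \<Omega>" "x \<in> \<Omega>"
  shows "pd i (pd j f) x = pd j (pd i f) x"
proof -
  obtain r where r: "r > 0" "ball x r \<subseteq> \<Omega>" using assms openE by blast
  then have C2r: "C2_on (ball x r) f" using C2 C2_on_subset by blast
  \<comment> \<open>Any null sequence of steps with \<open>2 h < r\<close> would do.\<close>
  define h where "h n = r / (3 * real (Suc n))" for n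
  have h: "0 < h n" "2 * h n < r" for n
    using r(1) by (auto simp: h_def field_simps intro: add_strict_increasing)
  have "(\<lambda>n. 2 * (r / 3) * inverse (real (Suc n))) \<longlonglongrightarrow> 2 * (r / 3) * 0"
    by (intro tendsto_intros LIMSEQ_inverse_real_of_nat)
  then have h0: "(\<lambda>n. 2 * h n) \<longlonglongrightarrow> 0" by (simp add: h_def field_simps)
  have "\<exists>p q. dist x p \<le> 2 * h n \<and> dist x q \<le> 2 * h n \<and> pd i (pd j f) p = pd j (pd i f) q" for n
  proof -
    obtain p where p: "dist x p \<le> 2 * h n"
      "f (x + h n *\<^sub>R axis j 1 + h n *\<^sub>R axis i 1) - f (x + h n *\<^sub>R axis j 1) - f (x + h n *\<^sub>R axis i 1) + f x =
        (h n)\<^sup>2 * pd i (pd j f) p"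
      using second_difference_eq[OF C2r h[of n], of j i] by blast
    obtain q where q: "dist x q \<le> 2 * h n"
      "f (x + h n *\<^sub>R axis i 1 + h n *\<^sub>R axis j 1) - f (x + h n *\<^sub>R axis i 1) - f (x + h n *\<^sub>R axis j 1) + f x =
        (h n)\<^sup>2 * pd j (pd i f) q"
      using second_difference_eq[OF C2r h[of n], of i j] by blast
    have "(h n)\<^sup>2 * pd i (pd j f) p = (h n)\<^sup>2 * pd j (pd i f) q"
      unfolding p(2)[symmetric] q(2)[symmetric] by (simp add: algebra_simps)
    moreover have "(h n)\<^sup>2 \<noteq> 0" using h(1)[of n] by simp
    ultimately show ?thesis using p(1) q(1) by (metis mult_left_cancel)
  qed
  then obtain p q where pq: "\<And>n. dist x (p n) \<le> 2 * h n" "\<And>n. dist x (q n) \<le> 2 * h n"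
    "\<And>n. pd i (pd j f) (p n) = pd j (pd i f) (q n)"
    by metis
  have lim: "s \<longlonglongrightarrow> x" if "\<And>n. dist x (s n) \<le> 2 * h n" for s
    unfolding tendsto_dist_iff[of s] by (rule Lim_null_comparison[OF _ h0]) (use that in \<open>auto simp: dist_commute\<close>)
  have cont: "isCont (pd a (pd b f)) x" for a b
    using C2 assms(2,3) continuous_on_eq_continuous_at unfolding C2_on_def C1_on_def by blast
  have "(\<lambda>n. pd i (pd j f) (p n)) \<longlonglongrightarrow> pd i (pd j f) x"
    by (rule isCont_tendsto_compose[OF cont lim[OF pq(1)]])
  moreover have "(\<lambda>n. pd i (pd j f) (p n)) \<longlonglongrightarrow> pd j (pd i f) x"
    unfolding pq(3) by (rule isCont_tendsto_compose[OF cont lim[OF pq(2)]])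
  ultimately show ?thesis by (rule LIMSEQ_unique)
qed

text \<open>Inner products with fixed vectors reduce the vector-valued case to the scalar one.\<close>

lemma pd_commute:
  fixes f :: "real^'n::finite \<Rightarrow> 'b::real_inner"
  assumes C2: "C2_on \<Omega> f" and "open \<Omega>" "x \<in> \<Omega>"
  shows "pd i (pd j f) x = pd j (pd i f) x"
proof -
  have *: "pd a (pd b (\<lambda>x. f x \<bullet> v)) x = pd a (pd b f) x \<bullet> v" for a b v
  proof -
    have "pd a (pd b (\<lambda>x. f x \<bullet> v)) x = pd a (\<lambda>x. pd b f x \<bullet> v) x"
      using C2 by (intro pd_cong[OF assms(2,3)] pd_linear bounded_linear_inner_left)
        (auto simp: C2_on_def C1_on_def)
    also have "\<dots> = pd a (pd b f) x \<bullet> v"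
      using C2 assms(3) by (intro pd_linear bounded_linear_inner_left) (auto simp: C2_on_def C1_on_def)
    finally show ?thesis .
  qed
  have "(pd i (pd j f) x - pd j (pd i f) x) \<bullet> v = 0" for v
    using pd_commute_real[OF C2_on_linear[OF assms(2) bounded_linear_inner_left C2] assms(2,3), of i j v]
    by (simp add: * inner_diff_left)
  then show ?thesis using inner_eq_zero_iff by (metis eq_iff_diff_eq_0)
qed

text \<open>The Poincare lemma on a ball. The potential is the integral of the form along the radius from \<open>a\<close>
  to \<open>x\<close>. Differentiating under the integral sign and using closedness turns the integrand of its
  \<open>k\<close>-th partial derivative into \<open>\<partial>/\<partial>t (t \<omega>\<^sub>k(a + t (x - a)))\<close>, which integrates to \<open>\<omega>\<^sub>k(x)\<close>.\<close>

lemma closed_form_exact_on_ball: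
  fixes \<omega> :: "'n::finite \<Rightarrow> real^'n \<Rightarrow> real"
  assumes C1: "\<And>i. C1_on (ball a r) (\<omega> i)"
    and closed: "\<And>i j x. x \<in> ball a r \<Longrightarrow> pd i (\<omega> j) x = pd j (\<omega> i) x"
  obtains F where "C2_on (ball a r) F" "\<forall>x\<in>ball a r. \<forall>i. pd i F x = \<omega> i x"
proof -
  let ?B = "ball a r"
  define \<gamma> where "\<gamma> x t = a + t *\<^sub>R (x - a)" for x :: "real^'n" and t :: real
  have \<gamma>B: "\<gamma> x t \<in> ?B" if "x \<in> ?B" "t \<in> cbox 0 1" for x t
  proof -
    have "norm (t *\<^sub>R (x - a)) \<le> norm (x - a)"
      using that by (simp add: mult_left_le_one_le)
    then show ?thesis using that by (simp add: \<gamma>_def dist_norm norm_minus_commute)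
  qed
  define f where "f x t = (\<Sum>i\<in>UNIV. \<omega> i (\<gamma> x t) * (x - a) $ i)" for x t
  define c where "c k x t = (\<Sum>i\<in>UNIV. t * pd k (\<omega> i) (\<gamma> x t) * (x - a) $ i) + \<omega> k (\<gamma> x t)" for k x t
  define fx where "fx x t = (\<Sum>k\<in>UNIV. c k x t *\<^sub>R blinfun_inner_left (axis k (1::real)))" for x t
  have fx_apply: "blinfun_apply (fx x t) h = (\<Sum>k\<in>UNIV. (h $ k) * c k x t)" for x t h
    by (simp add: fx_def blinfun.sum_left blinfun.scaleR_left inner_axis mult.commute)
  have cont_\<gamma>: "continuous_on (?B \<times> cbox 0 1) (\<lambda>z. \<gamma> (fst z) (snd z))"
    unfolding \<gamma>_def by (intro continuous_intros)
  have \<gamma>B': "(\<lambda>z. \<gamma> (fst z) (snd z)) ` (?B \<times> cbox 0 1) \<subseteq> ?B" using \<gamma>B by auto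
  have cont_c: "continuous_on (?B \<times> cbox 0 1) (\<lambda>z. c k (fst z) (snd z))" for k
    unfolding c_def
    by (intro continuous_intros continuous_on_compose2[OF C1_on_continuous_pd[OF C1] cont_\<gamma> \<gamma>B']
        continuous_on_compose2[OF C1_on_continuous[OF C1] cont_\<gamma> \<gamma>B'])
  have der_f: "((\<lambda>x. f x t) has_derivative blinfun_apply (fx x t)) (at x within ?B)"
    if x: "x \<in> ?B" and t: "t \<in> cbox 0 1" for x t
  proof -
    have \<gamma>': "((\<lambda>x. \<gamma> x t) has_derivative (\<lambda>h. t *\<^sub>R h)) (at x within ?B)"
      unfolding \<gamma>_def by (auto intro!: derivative_eq_intros)
    have "((\<lambda>x. \<omega> i (\<gamma> x t)) has_derivative
        (\<lambda>h. \<Sum>k\<in>UNIV. (t *\<^sub>R h) $ k *\<^sub>R pd k (\<omega> i) (\<gamma> x t))) (at x within ?B)" for i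
      by (rule has_derivative_compose[OF \<gamma>' C1_on_has_derivative[OF C1 \<gamma>B[OF x t]]])
    then have "((\<lambda>x. f x t) has_derivative
        (\<lambda>h. \<Sum>i\<in>UNIV. \<omega> i (\<gamma> x t) * h $ i +
           (\<Sum>k\<in>UNIV. (t *\<^sub>R h) $ k *\<^sub>R pd k (\<omega> i) (\<gamma> x t)) * (x - a) $ i)) (at x within ?B)"
      unfolding f_def by (auto intro!: derivative_eq_intros bounded_linear.has_derivative[OF bounded_linear_vec_nth])
    moreover have "(\<lambda>h. \<Sum>i\<in>UNIV. \<omega> i (\<gamma> x t) * h $ i +
           (\<Sum>k\<in>UNIV. (t *\<^sub>R h) $ k *\<^sub>R pd k (\<omega> i) (\<gamma> x t)) * (x - a) $ i) = blinfun_apply (fx x t)"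
    proof
      fix h :: "real^'n"
      have "(\<Sum>i\<in>UNIV. (\<Sum>k\<in>UNIV. (t *\<^sub>R h) $ k *\<^sub>R pd k (\<omega> i) (\<gamma> x t)) * (x - a) $ i) =
            (\<Sum>i\<in>UNIV. \<Sum>k\<in>UNIV. h $ k * (t * pd k (\<omega> i) (\<gamma> x t) * (x - a) $ i))"
        by (intro sum.cong) (simp_all add: sum_distrib_left sum_distrib_right mult_ac)
      also have "\<dots> = (\<Sum>k\<in>UNIV. \<Sum>i\<in>UNIV. h $ k * (t * pd k (\<omega> i) (\<gamma> x t) * (x - a) $ i))"
        by (rule sum.swap)
      finally show "(\<Sum>i\<in>UNIV. \<omega> i (\<gamma> x t) * h $ i +
           (\<Sum>k\<in>UNIV. (t *\<^sub>R h) $ k *\<^sub>R pd k (\<omega> i) (\<gamma> x t)) * (x - a) $ i) = blinfun_apply (fx x t) h"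
        by (simp add: fx_apply c_def sum.distrib sum_distrib_left distrib_left mult.commute)
    qed
    ultimately show ?thesis by simp
  qed
  define F where "F x = integral (cbox 0 1) (f x)" for x
  have slice: "continuous_on (cbox 0 1) (\<lambda>t. g x t)"
    if "continuous_on (?B \<times> cbox 0 1) (\<lambda>z. g (fst z) (snd z))" "x \<in> ?B"
    for g :: "real^'n \<Rightarrow> real \<Rightarrow> 'z::topological_space" and x
  proof -
    have "continuous_on (cbox 0 1) (\<lambda>t::real. (x, t))"
      by (rule continuous_on_Pair[OF continuous_on_const continuous_on_id])
    moreover have "(\<lambda>t. (x, t)) ` cbox 0 1 \<subseteq> ?B \<times> cbox 0 1" using that(2) by blast
    ultimately show ?thesis using continuous_on_compose2[OF that(1)] by fastforce
  qed
  have cont_f: "continuous_on (?B \<times> cbox 0 1) (\<lambda>z. f (fst z) (snd z))"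
    unfolding f_def by (intro continuous_intros continuous_on_compose2[OF C1_on_continuous[OF C1] cont_\<gamma> \<gamma>B'])
  have cont_fx: "continuous_on (?B \<times> cbox 0 1) (\<lambda>z. fx (fst z) (snd z))"
    unfolding fx_def by (intro continuous_intros cont_c)
  have derF: "(F has_derivative (\<lambda>h. \<Sum>i\<in>UNIV. (h $ i) *\<^sub>R \<omega> i x)) (at x)" if x: "x \<in> ?B" for x
  proof -
    have "(F has_derivative integral (cbox 0 1) (fx x)) (at x within ?B)"
      unfolding F_def
      by (rule leibniz_rule[OF der_f])
        (use x slice[OF cont_f] cont_fx in \<open>auto simp: split_beta' intro: integrable_continuous integrable_continuous_real\<close>)
    then have "(F has_derivative integral (cbox 0 1) (fx x)) (at x)"
      using at_within_open[OF x open_ball] by simp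
    moreover have "blinfun_apply (integral (cbox 0 1) (fx x)) h = (\<Sum>k\<in>UNIV. (h $ k) *\<^sub>R \<omega> k x)" for h
    proof -
      have int: "((\<lambda>t. c k x t) has_integral (1 *\<^sub>R \<omega> k (\<gamma> x 1) - 0 *\<^sub>R \<omega> k (\<gamma> x 0))) {0..1}" for k
      proof (rule fundamental_theorem_of_calculus)
        fix t :: real assume "t \<in> {0..1}"
        then have t: "t \<in> cbox 0 1" by simp
        have \<gamma>t: "(\<gamma> x has_derivative (\<lambda>s. s *\<^sub>R (x - a))) (at t within {0..1})"
          unfolding \<gamma>_def by (auto intro!: derivative_eq_intros)
        have "((\<lambda>t. \<omega> k (\<gamma> x t)) has_derivative
            (\<lambda>s. \<Sum>i\<in>UNIV. (s *\<^sub>R (x - a)) $ i *\<^sub>R pd i (\<omega> k) (\<gamma> x t))) (at t within {0..1})"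
          by (rule has_derivative_compose[OF \<gamma>t C1_on_has_derivative[OF C1 \<gamma>B[OF x t]]])
        then have "((\<lambda>t. t *\<^sub>R \<omega> k (\<gamma> x t)) has_derivative
            (\<lambda>s. t *\<^sub>R (\<Sum>i\<in>UNIV. (s *\<^sub>R (x - a)) $ i *\<^sub>R pd i (\<omega> k) (\<gamma> x t)) + s *\<^sub>R \<omega> k (\<gamma> x t)))
            (at t within {0..1})"
          by (auto intro!: derivative_eq_intros)
        moreover have "(\<lambda>s. t *\<^sub>R (\<Sum>i\<in>UNIV. (s *\<^sub>R (x - a)) $ i *\<^sub>R pd i (\<omega> k) (\<gamma> x t)) + s *\<^sub>R \<omega> k (\<gamma> x t))
            = (\<lambda>s. s *\<^sub>R c k x t)"
          using closed[OF \<gamma>B[OF x t], of k]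
          by (auto simp: c_def algebra_simps sum_distrib_left)
        ultimately show "((\<lambda>t. t *\<^sub>R \<omega> k (\<gamma> x t)) has_vector_derivative c k x t) (at t within {0..1})"
          by (simp add: has_vector_derivative_def)
      qed simp
      have "blinfun_apply (integral (cbox 0 1) (fx x)) h = integral (cbox 0 1) (\<lambda>t. \<Sum>k\<in>UNIV. (h $ k) * c k x t)"
        by (subst blinfun_apply_integral)
          (use slice[OF cont_fx x] in \<open>auto simp: fx_apply intro: integrable_continuous integrable_continuous_real\<close>)
      also have "\<dots> = (\<Sum>k\<in>UNIV. (h $ k) * \<omega> k x)"
        using int by (intro integral_unique has_integral_sum has_integral_mult_right)
          (auto simp: \<gamma>_def)
      finally show ?thesis by simp
    qed
    then have "blinfun_apply (integral (cbox 0 1) (fx x)) = (\<lambda>h. \<Sum>k\<in>UNIV. (h $ k) *\<^sub>R \<omega> k x)"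
      by (rule ext)
    ultimately show ?thesis by simp
  qed
  have "C2_on ?B F" by (rule C2_onI[OF open_ball derF C1])
  moreover have "pd i F x = \<omega> i x" if "x \<in> ?B" for i x
    by (rule C1_onI(2)[OF open_ball derF C1_on_continuous[OF C1] that])
  ultimately show thesis using that by blast
qed

section \<open>Inverse functions and immersions\<close>

lemma bounded_bilinear_cross3: "bounded_bilinear cross3"
  using bilinear_cross by (simp add: bilinear_conv_bounded_bilinear)

lemma grad_nth: "grad u x $ a $ i = pd i u x $ a"
  by (simp add: jacobian_def matrix_def pd_def)

lemma grad_mult_eq:
  fixes u :: "real^2 \<Rightarrow> real^'m::finite"
  shows "grad u x *v h = (h $ 1) *\<^sub>R pd 1 u x + (h $ 2) *\<^sub>R pd 2 u x"
  by (simp add: vec_eq_iff matrix_vector_mult_def grad_nth sum_2 mult.commute)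

lemma grad_chain:
  assumes "g differentiable (at x)" "f differentiable (at (g x))"
  shows "grad (\<lambda>x. f (g x)) x *v h = grad f (g x) *v (grad g x *v h)"
proof -
  have "((\<lambda>x. f (g x)) has_derivative (\<lambda>h. grad f (g x) *v (grad g x *v h))) (at x)"
    using assms unfolding jacobian_works by (rule has_derivative_compose)
  then have "(\<lambda>h. grad f (g x) *v (grad g x *v h)) = (\<lambda>h. grad (\<lambda>x. f (g x)) x *v h)"
    using has_derivative_unique jacobian_works differentiableI by blast
  then show ?thesis by metis
qed

lemma grad_cong:
  assumes "open U" "x \<in> U" "\<And>y. y \<in> U \<Longrightarrow> f y = g y"
  shows "grad f x = grad g x"
  using pd_cong[OF assms] by (simp add: vec_eq_iff grad_nth)

text \<open>The cross product of the partial derivatives is the form in which the immersion condition is used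
  below.\<close>

lemma rank_grad_eq_2_iff:
  fixes u :: "real^2 \<Rightarrow> real^3"
  shows "rank (grad u x) = 2 \<longleftrightarrow> cross3 (pd 1 u x) (pd 2 u x) \<noteq> 0"
proof -
  let ?a = "pd 1 u x" and ?b = "pd 2 u x"
  have "rank (grad u x) = 2 \<longleftrightarrow> inj ((*v) (grad u x))"
    using full_rank_injective[of "grad u x"] by simp
  also have "\<dots> \<longleftrightarrow> (\<forall>h. grad u x *v h = 0 \<longrightarrow> h = 0)"
    using linear_injective_0[OF matrix_vector_mul_linear] by blast
  also have "\<dots> \<longleftrightarrow> cross3 ?a ?b \<noteq> 0"
  proof
    assume inj: "\<forall>h. grad u x *v h = 0 \<longrightarrow> h = 0"
    show "cross3 ?a ?b \<noteq> 0"
    proof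
      assume "cross3 ?a ?b = 0"
      then consider "?a = 0" | "?b = 0" | c where "?b = c *\<^sub>R ?a"
        by (auto simp: cross_eq_0 collinear_lemma)
      then show False
      proof cases
        case 1
        then show False using inj[rule_format, of "vector [1, 0]"]
          by (simp add: grad_mult_eq vector_2 vec_eq_iff forall_2)
      next
        case 2
        then show False using inj[rule_format, of "vector [0, 1]"]
          by (simp add: grad_mult_eq vector_2 vec_eq_iff forall_2)
      next
        case 3
        then show False using inj[rule_format, of "vector [c, -1]"]
          by (simp add: grad_mult_eq vector_2 vec_eq_iff forall_2)
      qed
    qed
  next
    assume ab: "cross3 ?a ?b \<noteq> 0"
    show "\<forall>h. grad u x *v h = 0 \<longrightarrow> h = 0"
    proof (intro allI impI)
      fix h assume h: "grad u x *v h = 0"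
      have "cross3 (grad u x *v h) ?b = h $ 1 *\<^sub>R cross3 ?a ?b"
        by (simp add: grad_mult_eq cross_add_left cross_mult_left)
      moreover have "cross3 ?a (grad u x *v h) = h $ 2 *\<^sub>R cross3 ?a ?b"
        by (simp add: grad_mult_eq cross_add_right cross_mult_right)
      ultimately have "h $ 1 = 0 \<and> h $ 2 = 0" using h ab by simp
      then show "h = 0" by (simp add: vec_eq_iff forall_2)
    qed
  qed
  finally show ?thesis .
qed

definition jacobian_det :: "(real^2 \<Rightarrow> real^2) \<Rightarrow> real^2 \<Rightarrow> real"
  where "jacobian_det f x = pd 1 f x $ 1 * pd 2 f x $ 2 - pd 1 f x $ 2 * pd 2 f x $ 1"

lemma C1_on_jacobian_det:
  assumes "open \<Omega>" "C2_on \<Omega> f"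
  shows "C1_on \<Omega> (jacobian_det f)"
  unfolding jacobian_det_def [abs_def]
  by (intro C1_on_diff C1_on_bilinear[OF _ bounded_bilinear_mult] C1_on_nth C2_on_C1_on_pd assms)

text \<open>The inverse function theorem gives a differentiable inverse \<open>g\<close> with \<open>Dg = (Df)\<^sup>-\<^sup>1 \<circ> g\<close>. Cramer's
  rule writes \<open>(Df)\<^sup>-\<^sup>1\<close> as a \<open>C\<^sup>1\<close> expression in the partial derivatives of \<open>f\<close>, so \<open>g\<close> is first
  \<open>C\<^sup>1\<close>, and then \<open>Dg\<close> is \<open>C\<^sup>1\<close> as a composition.\<close>

theorem C2_inverse_function:
  fixes f :: "real^2 \<Rightarrow> real^2"
  assumes "open \<Omega>" "C2_on \<Omega> f" "x0 \<in> \<Omega>" "jacobian_det f x0 \<noteq> 0"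
  obtains U V g where "open U" "U \<subseteq> \<Omega>" "x0 \<in> U" "open V" "homeomorphism U V f g" "C2_on V g"
proof -
  define U0 where "U0 = {x \<in> \<Omega>. jacobian_det f x \<noteq> 0}"
  have "U0 = \<Omega> \<inter> jacobian_det f -` (- {0})" by (auto simp: U0_def)
  then have U0: "open U0" "x0 \<in> U0" "U0 \<subseteq> \<Omega>"
    using continuous_open_preimage[OF C1_on_continuous[OF C1_on_jacobian_det[OF assms(1,2)]] assms(1), of "-{0}"] assms
    by (auto simp: U0_def)
  have C2: "C2_on U0 f" using assms(2) U0(3) C2_on_subset by blast
  have diff: "f differentiable (at x)" if "x \<in> U0" for x
    using C2 that by (auto simp: C2_on_def C1_on_def)
  define f' where "f' x = (\<Sum>i\<in>UNIV. blinfun_scaleR_left (pd i f x) o\<^sub>L blinfun_inner_left (axis i (1::real)))" for x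
  have f'_apply: "blinfun_apply (f' x) h = (h $ 1) *\<^sub>R pd 1 f x + (h $ 2) *\<^sub>R pd 2 f x"
    for x and h :: "real^2"
    by (simp add: f'_def blinfun.sum_left blinfun.add_left inner_axis sum_2)
  have derf: "(f has_derivative blinfun_apply (f' x)) (at x)" if "x \<in> U0" for x
    using has_derivative_pd[OF diff[OF that]] by (simp add: sum_2 f'_apply[abs_def])
  have contf: "continuous_on U0 f'"
    unfolding f'_def
    by (intro continuous_intros bounded_linear.continuous_on[OF bounded_linear_blinfun_scaleR_left]
        C1_on_continuous_pd C2_on_imp_C1_on C2)
  \<comment> \<open>The \<open>k\<close>-th column of the inverse of the gradient matrix of \<open>f\<close> at \<open>x\<close>.\<close>
  define A where "A k x = (inverse (jacobian_det f x) *\<^sub>R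
      ((axis k 1 $ 1 * pd 2 f x $ 2 - axis k 1 $ 2 * pd 2 f x $ 1) *\<^sub>R axis 1 1 +
       (axis k 1 $ 2 * pd 1 f x $ 1 - axis k 1 $ 1 * pd 1 f x $ 2) *\<^sub>R axis 2 1) :: real^2)"
    for k :: 2 and x
  have A: "blinfun_apply (f' x) (A k x) = axis k 1" if "x \<in> U0" for x k
  proof -
    have "jacobian_det f x \<noteq> 0" using that U0_def by blast
    then show ?thesis
      unfolding f'_apply A_def vec_eq_iff forall_2
      by (auto simp: axis_def field_simps) (auto simp: jacobian_det_def algebra_simps)
  qed
  have A': "blinfun_apply (f' x) ((h $ 1) *\<^sub>R A 1 x + (h $ 2) *\<^sub>R A 2 x) = h" if "x \<in> U0" for x and h :: "real^2"
    using that by (simp add: blinfun.add_right blinfun.scaleR_right A) (simp add: vec_eq_iff forall_2 axis_def)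
  have inj: "inj (blinfun_apply (f' x))" if "x \<in> U0" for x
  proof -
    have "surj (blinfun_apply (f' x))" unfolding surj_def using A'[OF that] by metis
    then show ?thesis
      using linear_surjective_imp_injective[OF bounded_linear.linear[OF blinfun.bounded_linear_right]] by blast
  qed
  define invf where "invf = (\<Sum>k\<in>UNIV. blinfun_scaleR_left (A k x0) o\<^sub>L blinfun_inner_left (axis k (1::real)))"
  have invf_apply: "blinfun_apply invf h = (h $ 1) *\<^sub>R A 1 x0 + (h $ 2) *\<^sub>R A 2 x0" for h :: "real^2"
    by (simp add: invf_def blinfun.sum_left blinfun.add_left inner_axis sum_2)
  have "blinfun_apply (invf o\<^sub>L f' x0) h = h" for h
    using injD[OF inj[OF U0(2)] A'[OF U0(2), of "blinfun_apply (f' x0) h"]] by (simp add: invf_apply)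
  then have "invf o\<^sub>L f' x0 = id_blinfun" by (intro blinfun_eqI) simp
  from inverse_function_theorem[OF U0(1) derf contf U0(2) this]
  obtain U V g g' where U: "open U" "U \<subseteq> U0" "x0 \<in> U" "open V" "homeomorphism U V f g"
    and g: "\<And>y. y \<in> V \<Longrightarrow> (g has_derivative g' y) (at y)"
    and g': "\<And>y. y \<in> V \<Longrightarrow> g' y = inv (blinfun_apply (f' (g y)))"
    by metis
  have gV: "g ` V \<subseteq> U0" and contg: "continuous_on V g"
    using U(2,5) by (auto simp: homeomorphism_def)
  have "g' y h = (h $ 1) *\<^sub>R A 1 (g y) + (h $ 2) *\<^sub>R A 2 (g y)" if "y \<in> V" for y and h :: "real^2"
    using A'[of "g y" h] inj[of "g y"] gV that by (auto simp: g' inv_f_eq)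
  then have "g' y = (\<lambda>h. \<Sum>k\<in>UNIV. (h $ k) *\<^sub>R A k (g y))" if "y \<in> V" for y
    using that by (simp add: fun_eq_iff sum_2)
  then have derg: "(g has_derivative (\<lambda>h. \<Sum>k\<in>UNIV. (h $ k) *\<^sub>R A k (g y))) (at y)" if "y \<in> V" for y
    using g[OF that] that by simp
  have det0: "jacobian_det f x \<noteq> 0" if "x \<in> U0" for x using that by (simp add: U0_def)
  have C1A: "C1_on U0 (A k)" for k
    unfolding A_def[abs_def]
    by (intro C1_on_bilinear[OF _ bounded_bilinear_scaleR] C1_on_add C1_on_diff C1_on_const
        C1_on_bilinear[OF _ bounded_bilinear_mult] C1_on_nth C2_on_C1_on_pd C2 U0
        C1_on_scalar[OF U0(1) C1_on_jacobian_det[OF U0(1) C2], where \<phi> = inverse and \<phi>' = "\<lambda>t. - (inverse t * inverse t)"])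
      (auto intro!: DERIV_inverse' derivative_eq_intros continuous_intros simp: det0)
  have contA: "continuous_on V (\<lambda>y. A k (g y))" for k
    by (rule continuous_on_compose2[OF C1_on_continuous[OF C1A] contg gV])
  have "C1_on V g" by (rule C1_onI(1)[OF U(4) derg contA])
  then have "C1_on V (\<lambda>y. A k (g y))" for k by (rule C1_on_compose[OF U(4) C1A _ gV])
  then have "C2_on V g" using C2_onI[OF U(4) derg] by blast
  then show thesis using that U U0(3) by blast
qed

text \<open>Composing \<open>u\<close> with the orthogonal projection to its tangent plane at \<open>x0\<close> (in the coordinates
  given by \<open>Du(x0)\<^sup>\<top>\<close>) yields a planar map with invertible derivative \<open>Du(x0)\<^sup>\<top> Du(x0)\<close>. Its local inverse after
  the projection is a left inverse of \<open>u\<close> that is defined and \<open>C\<^sup>2\<close> on an open set of the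
  ambient space.\<close>

lemma C2_immersion_left_inverse:
  fixes u :: "real^2 \<Rightarrow> real^3"
  assumes "open \<Omega>" "C2_on \<Omega> u" "x0 \<in> \<Omega>" "rank (grad u x0) = 2"
  obtains N W \<psi> where "open N" "x0 \<in> N" "N \<subseteq> \<Omega>" "open W" "u ` N \<subseteq> W" "C2_on W \<psi>"
    "\<forall>x\<in>N. \<psi> (u x) = x"
proof -
  define L :: "real^3 \<Rightarrow> real^2"
    where "L p = (p \<bullet> pd 1 u x0) *\<^sub>R axis 1 1 + (p \<bullet> pd 2 u x0) *\<^sub>R axis 2 1" for p
  have L: "bounded_linear L"
    unfolding L_def [abs_def]
    by (intro bounded_linear_add bounded_linear_scaleR_left bounded_linear_compose[OF bounded_linear_scaleR_left]
        bounded_linear_inner_left)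
  define f where "f x = L (u x)" for x
  have C2f: "C2_on \<Omega> f"
    unfolding f_def[abs_def] by (rule C2_on_linear[OF assms(1) L assms(2)])
  have "pd i f x0 = L (pd i u x0)" for i
    unfolding f_def[abs_def] using assms by (intro pd_linear L) (auto simp: C2_on_def C1_on_def)
  then have "jacobian_det f x0 = (norm (cross3 (pd 1 u x0) (pd 2 u x0)))\<^sup>2"
    unfolding power2_norm_eq_inner dot_cross
    by (simp add: jacobian_det_def L_def axis_def inner_commute)
  then have "jacobian_det f x0 \<noteq> 0" using assms(4) by (simp add: rank_grad_eq_2_iff)
  then obtain U V g where U: "open U" "U \<subseteq> \<Omega>" "x0 \<in> U" "open V" "homeomorphism U V f g" "C2_on V g"
    using C2_inverse_function[OF assms(1) C2f assms(3)] by metis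
  define W where "W = L -` V"
  have contL: "continuous_on UNIV L" using L by (simp add: linear_continuous_on)
  have "open W"
    unfolding W_def using U(4) contL by (simp add: open_vimage)
  have "C2_on W L" using C2_on_linear[OF \<open>open W\<close> L C2_on_ident[OF \<open>open W\<close>]] .
  then have "C2_on W (\<lambda>p. g (L p))"
    by (intro C2_on_compose[OF \<open>open W\<close> U(6)]) (auto simp: W_def)
  moreover have "u ` U \<subseteq> W" "g (L (u x)) = x" if "x \<in> U" for x
    using U(5) that by (auto simp: homeomorphism_def W_def f_def)
  ultimately show thesis
    using that[of U W "\<lambda>p. g (L p)"] U \<open>open W\<close> by blast
qed

section \<open>Local parametrizations and atlases\<close>

lemma local_paramD:
  assumes "local_param S \<Omega> u"
  shows "open \<Omega>" "C2_on \<Omega> u" "openin (top_of_set S) (u ` \<Omega>)"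
    "\<And>x. x \<in> \<Omega> \<Longrightarrow> cross3 (pd 1 u x) (pd 2 u x) \<noteq> 0"
    "\<And>x. x \<in> \<Omega> \<Longrightarrow> u differentiable (at x)"
    "\<And>x i. x \<in> \<Omega> \<Longrightarrow> pd i u differentiable (at x)"
  using assms by (auto simp: local_param_def rank_grad_eq_2_iff C2_on_def C1_on_def)

lemma local_param_restrict:
  assumes "local_param S \<Omega> u" "open \<Omega>'" "\<Omega>' \<subseteq> \<Omega>"
  shows "local_param S \<Omega>' u"
proof -
  obtain v where v: "homeomorphism \<Omega> (u ` \<Omega>) u v"
    using assms(1) by (auto simp: local_param_def)
  have "openin (top_of_set (u ` \<Omega>)) (u ` \<Omega>')"
    using homeomorphism_imp_open_map[OF v] assms(2,3) by (simp add: open_subset)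
  then have "openin (top_of_set S) (u ` \<Omega>')"
    using local_paramD(3)[OF assms(1)] openin_trans by blast
  moreover have "homeomorphism \<Omega>' (u ` \<Omega>') u v"
    using homeomorphism_of_subsets[OF v assms(3)] assms(3) by blast
  ultimately show ?thesis
    using assms C2_on_subset by (auto simp: local_param_def)
qed

lemma local_param_open_subset:
  assumes "openin (top_of_set S) U" "u ` \<Omega> \<subseteq> U"
  shows "local_param U \<Omega> u \<longleftrightarrow> local_param S \<Omega> u"
proof -
  have "openin (top_of_set U) (u ` \<Omega>) \<longleftrightarrow> openin (top_of_set S) (u ` \<Omega>)"
    using assms openin_trans openin_subset_trans openin_imp_subset by metis
  then show ?thesis by (simp add: local_param_def)
qed

lemma local_param_into_open_subset:
  assumes "local_param S \<Omega> u" "openin (top_of_set S) U"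
  shows "local_param U (\<Omega> \<inter> u -` U) u"
proof -
  obtain W where W: "open W" "U = S \<inter> W" using assms(2) by (auto simp: openin_open)
  have "u ` \<Omega> \<subseteq> S" using local_paramD(3)[OF assms(1)] openin_imp_subset by blast
  then have eq: "\<Omega> \<inter> u -` U = \<Omega> \<inter> u -` W" using W(2) by auto
  have "open (\<Omega> \<inter> u -` U)"
    unfolding eq using local_paramD(1,2)[OF assms(1)] W(1)
    by (intro continuous_open_preimage C1_on_continuous C2_on_imp_C1_on)
  then have "local_param S (\<Omega> \<inter> u -` U) u"
    using assms(1) local_param_restrict by blast
  then show ?thesis using local_param_open_subset[OF assms(2), of u "\<Omega> \<inter> u -` U"] by blast
qed

text \<open>The inverse chart \<open>v\<close> is only known to be continuous, but near each point it agrees on the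
  surface with the ambient \<open>C\<^sup>2\<close> left inverse of \<open>u\<close>. Continuity of \<open>v\<close> keeps \<open>v (w y)\<close> in the
  neighbourhood where this holds.\<close>

lemma transition_map_C2:
  assumes u: "local_param S \<Omega> u" and v: "homeomorphism \<Omega> (u ` \<Omega>) u v"
    and w: "local_param S \<Omega>' w"
  shows "open (\<Omega>' \<inter> w -` (u ` \<Omega>))" "C2_on (\<Omega>' \<inter> w -` (u ` \<Omega>)) (\<lambda>y. v (w y))"
proof -
  let ?M = "\<Omega>' \<inter> w -` (u ` \<Omega>)"
  show open_M: "open ?M"
    using local_paramD(1)[OF local_param_into_open_subset[OF w local_paramD(3)[OF u]]] .
  have cont_vw: "continuous_on ?M (\<lambda>y. v (w y))"
    using v C1_on_continuous[OF C2_on_imp_C1_on[OF local_paramD(2)[OF w]]]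
    by (auto simp: homeomorphism_def intro!: continuous_on_compose2[of "u ` \<Omega>" v] continuous_on_subset[of \<Omega>' w])
  show "C2_on ?M (\<lambda>y. v (w y))"
  proof (rule C2_on_pointwise)
    fix y0 assume y0: "y0 \<in> ?M"
    then have x0: "v (w y0) \<in> \<Omega>" using v by (auto simp: homeomorphism_def)
    then have "rank (grad u (v (w y0))) = 2" using u by (simp add: local_param_def)
    then obtain N W \<psi> where N: "open N" "v (w y0) \<in> N" "N \<subseteq> \<Omega>" "open W" "u ` N \<subseteq> W" "C2_on W \<psi>"
      "\<forall>x\<in>N. \<psi> (u x) = x"
      by (rule C2_immersion_left_inverse[OF local_paramD(1,2)[OF u] x0])
    let ?M' = "?M \<inter> (\<lambda>y. v (w y)) -` N"
    have open_M': "open ?M'" by (rule continuous_open_preimage[OF cont_vw open_M N(1)])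
    have uvw: "u (v (w y)) = w y" if "y \<in> ?M" for y using v that by (auto simp: homeomorphism_def)
    have "C2_on ?M' (\<lambda>y. \<psi> (w y))"
    proof (rule C2_on_compose[OF open_M' N(6)])
      show "C2_on ?M' w" by (rule C2_on_subset[OF local_paramD(2)[OF w]]) blast
      show "w ` ?M' \<subseteq> W"
      proof
        fix q assume "q \<in> w ` ?M'"
        then obtain y where y: "y \<in> ?M'" "q = w y" by blast
        then have "q = u (v (w y))" using uvw by simp
        then show "q \<in> W" using y(1) N(5) by blast
      qed
    qed
    moreover have "v (w y) = \<psi> (w y)" if "y \<in> ?M'" for y
      using N(7)[rule_format, of "v (w y)"] uvw[of y] that by simp
    ultimately have "C2_on ?M' (\<lambda>y. v (w y))" by (rule C2_on_cong[OF open_M'])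
    moreover have "y0 \<in> ?M'" using y0 N(2) by blast
    ultimately show "\<exists>U. open U \<and> y0 \<in> U \<and> C2_on U (\<lambda>y. v (w y))" using open_M' by blast
  qed
qed

text \<open>All charts with the required property form an atlas as soon as they cover, so only one chart
  around each point is needed.\<close>

lemma has_isothermal_atlas_iff:
  "has_isothermal_atlas S P \<longleftrightarrow>
     (\<forall>p\<in>S. \<exists>\<Omega> u. isothermal_param S \<Omega> u \<and> P \<Omega> u \<and> p \<in> u ` \<Omega>)" (is "_ \<longleftrightarrow> ?R")
proof
  assume "has_isothermal_atlas S P"
  then obtain \<A> where A: "\<forall>(\<Omega>, u)\<in>\<A>. isothermal_param S \<Omega> u \<and> P \<Omega> u" "(\<Union>(\<Omega>, u)\<in>\<A>. u ` \<Omega>) = S"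
    by (auto simp: has_isothermal_atlas_def)
  show ?R
  proof
    fix p assume "p \<in> S"
    then obtain \<Omega> u where "(\<Omega>, u) \<in> \<A>" "p \<in> u ` \<Omega>" using A(2) by force
    then show "\<exists>\<Omega> u. isothermal_param S \<Omega> u \<and> P \<Omega> u \<and> p \<in> u ` \<Omega>" using A(1) by blast
  qed
next
  assume R: ?R
  let ?A = "{(\<Omega>, u). isothermal_param S \<Omega> u \<and> P \<Omega> u}"
  have "u ` \<Omega> \<subseteq> S" if "isothermal_param S \<Omega> u" for \<Omega> u
    using that local_paramD(3) openin_imp_subset unfolding isothermal_param_def by blast
  then have "(\<Union>(\<Omega>, u)\<in>?A. u ` \<Omega>) = S" using R by fast
  then show "has_isothermal_atlas S P"
    unfolding has_isothermal_atlas_def by (intro exI[of _ ?A]) auto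
qed

lemma transpose_grad_mult_grad: "transpose (grad u x) ** grad u x = first_fund u x"
  for u :: "real^2 \<Rightarrow> real^3"
  by (simp add: vec_eq_iff matrix_matrix_mult_def transpose_def grad_nth first_fund_def inner_vec_def)

lemma conformal_imp_rank_2:
  fixes u :: "real^2 \<Rightarrow> real^3"
  assumes "pd 1 u x \<bullet> pd 2 u x = 0" "pd 2 u x \<bullet> pd 2 u x = pd 1 u x \<bullet> pd 1 u x" "pd 1 u x \<noteq> 0"
  shows "rank (grad u x) = 2"
proof -
  have "(norm (cross3 (pd 1 u x) (pd 2 u x)))\<^sup>2 = (pd 1 u x \<bullet> pd 1 u x)\<^sup>2"
    unfolding power2_norm_eq_inner dot_cross by (simp add: assms(1,2) power2_eq_square)
  then show ?thesis using assms(3) by (auto simp: rank_grad_eq_2_iff)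
qed

lemma conformal_inner_grad:
  fixes u :: "real^2 \<Rightarrow> real^3"
  assumes "pd 1 u x \<bullet> pd 2 u x = 0" "pd 2 u x \<bullet> pd 2 u x = pd 1 u x \<bullet> pd 1 u x"
  shows "(grad u x *v h) \<bullet> (grad u x *v k) = (pd 1 u x \<bullet> pd 1 u x) * (h \<bullet> k)"
  using assms by (simp add: grad_mult_eq inner_add_left inner_add_right inner_vec_def[of h] sum_2
      inner_commute[of "pd 2 u x" "pd 1 u x"] algebra_simps)

lemma isothermal_paramD:
  assumes "isothermal_param S \<Omega> u"
  shows "local_param S \<Omega> u"
    "\<And>x. x \<in> \<Omega> \<Longrightarrow> pd 1 u x \<bullet> pd 2 u x = 0"
    "\<And>x. x \<in> \<Omega> \<Longrightarrow> pd 2 u x \<bullet> pd 2 u x = pd 1 u x \<bullet> pd 1 u x"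
  using assms by (auto simp: isothermal_param_def transpose_grad_mult_grad first_fund_def
      vec_eq_iff forall_2 mat_def)

text \<open>The conformal factor can be taken as the length of the first column of \<open>Du\<close>, and this is \<open>C\<^sup>1\<close>
  because it does not vanish.\<close>

lemma isothermal_paramI:
  assumes u: "local_param S \<Omega> u"
    and orth: "\<And>x. x \<in> \<Omega> \<Longrightarrow> pd 1 u x \<bullet> pd 2 u x = 0"
    and eq: "\<And>x. x \<in> \<Omega> \<Longrightarrow> pd 2 u x \<bullet> pd 2 u x = pd 1 u x \<bullet> pd 1 u x"
  shows "isothermal_param S \<Omega> u"
proof -
  let ?G = "\<lambda>x. pd 1 u x \<bullet> pd 1 u x"
  have pos: "?G x > 0" if "x \<in> \<Omega>" for x
    using local_paramD(4)[OF u that] by auto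
  have "C1_on \<Omega> (\<lambda>x. sqrt (?G x))"
  proof (rule C1_on_scalar[where \<phi> = sqrt and \<phi>' = "\<lambda>t. inverse (sqrt t) / 2"])
    show "open \<Omega>" by (rule local_paramD(1)[OF u])
    show "C1_on \<Omega> ?G"
      using local_paramD(1,2)[OF u] by (intro C1_on_bilinear[OF _ bounded_bilinear_inner] C2_on_C1_on_pd)
    show "(sqrt has_real_derivative inverse (sqrt (?G x)) / 2) (at (?G x))" if "x \<in> \<Omega>" for x
      using DERIV_real_sqrt[OF pos[OF that]] .
    show "continuous_on (?G ` \<Omega>) (\<lambda>t. inverse (sqrt t) / 2)"
      by (intro continuous_intros) (use pos in force, simp)
  qed
  moreover have "transpose (grad u x) ** grad u x = mat ((sqrt (?G x))\<^sup>2)" if "x \<in> \<Omega>" for x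
    using orth[OF that] eq[OF that]
    by (simp add: transpose_grad_mult_grad first_fund_def vec_eq_iff forall_2 mat_def inner_commute)
  moreover have "sqrt (?G x) \<noteq> 0" if "x \<in> \<Omega>" for x using pos[OF that] by simp
  ultimately show ?thesis unfolding isothermal_param_def using u by blast
qed

section \<open>The two operators and the mean curvature\<close>

text \<open>This is how vectors of \<open>\<real>\<^sup>3\<close> are compared below: a vector vanishes once it is orthogonal to a
  tangent basis and to its cross product.\<close>

lemma orthogonal_to_frame_imp_zero:
  fixes z a b :: "real^3"
  assumes "cross3 a b \<noteq> 0" "z \<bullet> a = 0" "z \<bullet> b = 0" "z \<bullet> cross3 a b = 0"
  shows "z = 0"
proof -
  have "cross3 z (cross3 a b) = 0"
    using assms(2,3) by (simp add: Lagrange inner_commute)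
  then show ?thesis using norm_and_cross_eq_0[of z "cross3 a b"] assms by auto
qed

lemma unit_normal_orthogonal:
  "unit_normal u x \<bullet> pd i u x = 0" "pd i u x \<bullet> unit_normal u x = 0"
proof -
  have "pd i u x \<bullet> unit_normal u x = 0" for i
    using exhaust_2[of i] by (auto simp: unit_normal_def sgn_div_norm dot_cross_self)
  then show "unit_normal u x \<bullet> pd i u x = 0" "pd i u x \<bullet> unit_normal u x = 0"
    by (simp_all add: inner_commute)
qed

lemma unit_normal_unit:
  "cross3 (pd 1 u x) (pd 2 u x) \<noteq> 0 \<Longrightarrow> unit_normal u x \<bullet> unit_normal u x = 1"
  by (simp add: unit_normal_def norm_sgn flip: power2_norm_eq_inner)

lemma cross_eq_unit_normal:
  "cross3 (pd 1 u x) (pd 2 u x) = norm (cross3 (pd 1 u x) (pd 2 u x)) *\<^sub>R unit_normal u x"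
  by (cases "cross3 (pd 1 u x) (pd 2 u x) = 0") (simp_all add: unit_normal_def sgn_div_norm)

text \<open>The null space of \<open>Du\<^sup>\<top>\<close> is the orthogonal complement of the columns of \<open>Du\<close>, which is the
  normal line when \<open>u\<close> is an immersion.\<close>

lemma grad_perp_eq:
  assumes "cross3 (pd 1 u x) (pd 2 u x) \<noteq> 0"
  shows "grad_perp u x v = (v \<bullet> unit_normal u x) *\<^sub>R unit_normal u x"
proof -
  let ?n = "unit_normal u x"
  let ?N = "{v. transpose (grad u x) *v v = 0}"
  have "transpose (grad u x) *v z = (\<chi> i. z \<bullet> pd i u x)" for z
    by (simp add: vec_eq_iff matrix_vector_mult_def transpose_def grad_nth inner_vec_def mult.commute)
  then have N: "z \<in> ?N \<longleftrightarrow> z \<bullet> pd 1 u x = 0 \<and> z \<bullet> pd 2 u x = 0" for z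
    by (simp add: vec_eq_iff forall_2)
  have n: "(c *\<^sub>R ?n) \<in> ?N" for c
    unfolding N by (simp add: unit_normal_orthogonal)
  have line: "z = (z \<bullet> ?n) *\<^sub>R ?n" if "z \<in> ?N" for z
  proof -
    let ?z = "z - (z \<bullet> ?n) *\<^sub>R ?n"
    have "?z \<bullet> ?n = 0" by (simp add: inner_diff_left unit_normal_unit[OF assms])
    then have "?z \<bullet> cross3 (pd 1 u x) (pd 2 u x) = 0"
      by (subst cross_eq_unit_normal) simp
    moreover have "?z \<bullet> pd 1 u x = 0" "?z \<bullet> pd 2 u x = 0"
      using that unfolding N by (simp_all add: inner_diff_left unit_normal_orthogonal)
    ultimately have "?z = 0" by (intro orthogonal_to_frame_imp_zero[OF assms])
    then show ?thesis by simp
  qed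
  have "orth_proj ?N v = (v \<bullet> ?n) *\<^sub>R ?n"
    unfolding orth_proj_def
  proof (rule the_equality)
    show "(v \<bullet> ?n) *\<^sub>R ?n \<in> ?N \<and> (\<forall>z\<in>?N. orthogonal (v - (v \<bullet> ?n) *\<^sub>R ?n) z)"
    proof (intro conjI ballI n)
      fix z assume "z \<in> ?N"
      have "(v - (v \<bullet> ?n) *\<^sub>R ?n) \<bullet> ((z \<bullet> ?n) *\<^sub>R ?n) = 0"
        by (simp add: inner_diff_left unit_normal_unit[OF assms])
      then show "orthogonal (v - (v \<bullet> ?n) *\<^sub>R ?n) z"
        using line[OF \<open>z \<in> ?N\<close>] by (simp add: orthogonal_def)
    qed
  next
    fix w assume w: "w \<in> ?N \<and> (\<forall>z\<in>?N. orthogonal (v - w) z)"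
    then have "(v - w) \<bullet> (1 *\<^sub>R ?n) = 0" using n[of 1] unfolding orthogonal_def by blast
    then have "w \<bullet> ?n = v \<bullet> ?n" by (simp add: inner_diff_left)
    then show "w = (v \<bullet> ?n) *\<^sub>R ?n" using line[of w] w by metis
  qed
  then show ?thesis by (simp add: grad_perp_def)
qed

lemma norm_op_eq:
  assumes "cross3 (pd 1 u x) (pd 2 u x) \<noteq> 0"
  shows "norm_op u x = ((norm (grad u x))\<^sup>2 * (laplacian u x \<bullet> unit_normal u x)) *\<^sub>R unit_normal u x"
  by (simp add: norm_op_def grad_perp_eq[OF assms])

lemma norm_op_eq_0_iff:
  assumes "cross3 (pd 1 u x) (pd 2 u x) \<noteq> 0"
  shows "norm_op u x = 0 \<longleftrightarrow> laplacian u x \<bullet> unit_normal u x = 0"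
proof -
  have "pd 1 u x = 0" if "grad u x = 0"
    using that grad_nth[of u x _ 1] by (simp add: vec_eq_iff)
  then have "grad u x \<noteq> 0" using assms by auto
  moreover have "unit_normal u x \<noteq> 0" using unit_normal_unit[OF assms] by auto
  ultimately show ?thesis by (simp add: norm_op_eq[OF assms])
qed

lemma tang_op_eq:
  "tang_op u x = (\<Sum>i\<in>UNIV. (\<Sum>j\<in>UNIV. pd i (pd j u) x \<bullet> pd j u x) *\<^sub>R pd i u x)"
  by (simp add: tang_op_def vec_eq_iff grad_nth inner_vec_def sum_distrib_left sum_distrib_right mult_ac)

lemma tang_op_eq_0_iff:
  assumes "cross3 (pd 1 u x) (pd 2 u x) \<noteq> 0"
  shows "tang_op u x = 0 \<longleftrightarrow> (\<forall>i. (\<Sum>j\<in>UNIV. pd i (pd j u) x \<bullet> pd j u x) = 0)"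
proof -
  define c where "c i = (\<Sum>j\<in>UNIV. pd i (pd j u) x \<bullet> pd j u x)" for i
  have "tang_op u x = c 1 *\<^sub>R pd 1 u x + c 2 *\<^sub>R pd 2 u x"
    by (simp add: tang_op_eq c_def sum_2)
  then have "cross3 (tang_op u x) (pd 2 u x) = c 1 *\<^sub>R cross3 (pd 1 u x) (pd 2 u x)"
    "cross3 (pd 1 u x) (tang_op u x) = c 2 *\<^sub>R cross3 (pd 1 u x) (pd 2 u x)"
    by (simp_all add: cross_add_left cross_add_right cross_mult_left cross_mult_right)
  then have "tang_op u x = 0 \<Longrightarrow> c i = 0" for i
    using assms exhaust_2[of i] by auto
  moreover have "tang_op u x = 0" if "\<And>i. c i = 0"
    using that by (simp add: tang_op_eq c_def)
  ultimately show ?thesis unfolding c_def by blast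
qed

lemma matrix_inv_eqI:
  fixes A B :: "real^'n::finite^'n"
  assumes "A ** B = mat 1"
  shows "matrix_inv A = B"
proof -
  have BA: "B ** A = mat 1" using assms by (simp add: matrix_left_right_inverse)
  then have "A ** matrix_inv A = mat 1"
    unfolding matrix_inv_def using assms by (metis (mono_tags, lifting) someI_ex)
  then have "B ** A ** matrix_inv A = B"
    by (metis matrix_mul_assoc matrix_mul_rid)
  then show ?thesis by (simp add: BA)
qed

lemma mean_curvature_eq:
  fixes u :: "real^2 \<Rightarrow> real^3"
  assumes "cross3 (pd 1 u x) (pd 2 u x) \<noteq> 0"
  shows "mean_curvature u x =
    ((pd 2 u x \<bullet> pd 2 u x) * (pd 1 (pd 1 u) x \<bullet> unit_normal u x)
      - (pd 1 u x \<bullet> pd 2 u x) * (pd 1 (pd 2 u) x \<bullet> unit_normal u x + pd 2 (pd 1 u) x \<bullet> unit_normal u x)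
      + (pd 1 u x \<bullet> pd 1 u x) * (pd 2 (pd 2 u) x \<bullet> unit_normal u x))
    / (2 * (norm (cross3 (pd 1 u x) (pd 2 u x)))\<^sup>2)"
proof -
  define E F G where EFG: "E = pd 1 u x \<bullet> pd 1 u x" "F = pd 1 u x \<bullet> pd 2 u x" "G = pd 2 u x \<bullet> pd 2 u x"
  define d where "d = E * G - F * F"
  have d: "(norm (cross3 (pd 1 u x) (pd 2 u x)))\<^sup>2 = d"
    unfolding power2_norm_eq_inner dot_cross EFG d_def by (simp add: inner_commute)
  then have d0: "d \<noteq> 0" using assms by auto
  let ?B = "vector [vector [G / d, - F / d], vector [- F / d, E / d]] :: real^2^2"
  have "first_fund u x = vector [vector [E, F], vector [F, G]]"
    by (simp add: vec_eq_iff forall_2 first_fund_def EFG inner_commute)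
  moreover have "E * G / d - F * F / d = d / d"
    by (metis d_def diff_divide_distrib)
  then have "vector [vector [E, F], vector [F, G]] ** ?B = mat 1"
    using d0 by (simp add: vec_eq_iff forall_2 matrix_matrix_mult_def mat_def sum_2 mult.commute)
  ultimately have inv: "matrix_inv (first_fund u x) = ?B" by (simp add: matrix_inv_eqI)
  show ?thesis
    unfolding mean_curvature_def inv d using d0
    by (simp add: trace_def matrix_matrix_mult_def sum_2 second_fund_def EFG[symmetric] field_simps)
qed

text \<open>With \<open>E = G\<close> and \<open>F = 0\<close> the trace of the shape operator is \<open>(\<Delta>u \<bullet> n) / E\<close>.\<close>

lemma mean_curvature_conformal:
  fixes u :: "real^2 \<Rightarrow> real^3"
  assumes "isothermal_param S \<Omega> u" "x \<in> \<Omega>"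
  shows "mean_curvature u x = 0 \<longleftrightarrow> norm_op u x = 0"
proof -
  have c: "cross3 (pd 1 u x) (pd 2 u x) \<noteq> 0"
    using assms isothermal_paramD(1) local_paramD(4) by blast
  then have "pd 1 u x \<noteq> 0" by auto
  then show ?thesis
    using c isothermal_paramD(2,3)[OF assms]
    by (auto simp: mean_curvature_eq[OF c] norm_op_eq_0_iff[OF c] laplacian_def sum_2 inner_add_left
        simp flip: distrib_left)
qed

section \<open>Change of parametrization\<close>

lemma pd_sum:
  assumes "\<And>a. a \<in> A \<Longrightarrow> f a differentiable (at x)"
  shows "pd i (\<lambda>x. \<Sum>a\<in>A. f a x) x = (\<Sum>a\<in>A. pd i (f a) x)"
proof -
  have "((\<lambda>x. \<Sum>a\<in>A. f a x) has_derivative (\<lambda>h. \<Sum>a\<in>A. frechet_derivative (f a) (at x) h)) (at x)"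
    by (rule has_derivative_sum) (use assms frechet_derivative_works in blast)
  from pd_eqI[OF this, of i] show ?thesis by (simp add: pd_def)
qed

lemma pd_chain_2:
  fixes \<tau> :: "real^2 \<Rightarrow> real^2"
  assumes "\<tau> differentiable (at y)" "u differentiable (at (\<tau> y))"
  shows "pd i (\<lambda>y. u (\<tau> y)) y = (pd i \<tau> y $ 1) *\<^sub>R pd 1 u (\<tau> y) + (pd i \<tau> y $ 2) *\<^sub>R pd 2 u (\<tau> y)"
  using pd_chain[OF assms] by (simp add: sum_2)

lemma cross_pd_chain:
  fixes \<tau> :: "real^2 \<Rightarrow> real^2" and u :: "real^2 \<Rightarrow> real^3"
  assumes "\<tau> differentiable (at y)" "u differentiable (at (\<tau> y))"
  shows "cross3 (pd 1 (\<lambda>y. u (\<tau> y)) y) (pd 2 (\<lambda>y. u (\<tau> y)) y) =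
    jacobian_det \<tau> y *\<^sub>R cross3 (pd 1 u (\<tau> y)) (pd 2 u (\<tau> y))"
  unfolding pd_chain_2[OF assms] jacobian_det_def
  by (simp add: cross_add_left cross_add_right cross_mult_left cross_mult_right
      cross_skew[of "pd 2 u (\<tau> y)" "pd 1 u (\<tau> y)"] algebra_simps)

text \<open>The second derivatives of \<open>\<tau>\<close> enter the chain rule only through tangential terms, which \<open>n\<close>
  annihilates: the second fundamental form transforms as a tensor.\<close>

lemma second_pd_chain_normal:
  fixes \<tau> :: "real^2 \<Rightarrow> real^2" and u :: "real^2 \<Rightarrow> real^3"
  assumes M: "open M" "C2_on M \<tau>" and u: "C2_on \<Omega> u" and y: "y \<in> M" "\<tau> ` M \<subseteq> \<Omega>"
    and n: "\<And>a. pd a u (\<tau> y) \<bullet> n = 0"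
  shows "pd i (pd j (\<lambda>y. u (\<tau> y))) y \<bullet> n =
    (\<Sum>a\<in>UNIV. \<Sum>b\<in>UNIV. pd j \<tau> y $ a * pd i \<tau> y $ b * (pd b (pd a u) (\<tau> y) \<bullet> n))"
proof -
  have dif: "\<tau> differentiable (at z)" "pd k \<tau> differentiable (at z)"
    "u differentiable (at (\<tau> z))" "pd k u differentiable (at (\<tau> z))" if "z \<in> M" for z k
    using M(2) u y(2) that by (auto simp: C2_on_def C1_on_def)
  have dif': "(\<lambda>y. pd j \<tau> y $ a) differentiable (at y)" "(\<lambda>y. pd a u (\<tau> y)) differentiable (at y)" for a
  proof -
    show "(\<lambda>y. pd j \<tau> y $ a) differentiable (at y)"
      using bounded_linear.has_derivative[OF bounded_linear_vec_nth has_derivative_pd[OF dif(2)[OF y(1)]]]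
      unfolding differentiable_def by blast
    show "(\<lambda>y. pd a u (\<tau> y)) differentiable (at y)"
      using has_derivative_chain_pd[OF dif(1)[OF y(1)] dif(4)[OF y(1)]]
      unfolding differentiable_def by blast
  qed
  have dif'': "(\<lambda>y. pd j \<tau> y $ a *\<^sub>R pd a u (\<tau> y)) differentiable (at y)" for a
    using has_derivative_scaleR[OF has_derivative_pd[OF dif'(1)] has_derivative_pd[OF dif'(2)]]
    unfolding differentiable_def by blast
  have "pd i (pd j (\<lambda>y. u (\<tau> y))) y = pd i (\<lambda>y. \<Sum>a\<in>UNIV. pd j \<tau> y $ a *\<^sub>R pd a u (\<tau> y)) y"
    by (rule pd_cong[OF M(1) y(1)]) (rule pd_chain[OF dif(1,3)])
  also have "\<dots> = (\<Sum>a\<in>UNIV. pd i (\<lambda>y. pd j \<tau> y $ a *\<^sub>R pd a u (\<tau> y)) y)"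
    by (rule pd_sum) (rule dif'')
  also have "\<dots> = (\<Sum>a\<in>UNIV. pd j \<tau> y $ a *\<^sub>R (\<Sum>b\<in>UNIV. pd i \<tau> y $ b *\<^sub>R pd b (pd a u) (\<tau> y))
      + pd i (\<lambda>y. pd j \<tau> y $ a) y *\<^sub>R pd a u (\<tau> y))"
    by (simp only: pd_bilinear[OF bounded_bilinear_scaleR dif'] pd_chain[OF dif(1,4)[OF y(1)]])
  finally show ?thesis
    by (simp add: inner_sum_left inner_add_left n sum_distrib_left mult.assoc)
qed

text \<open>Both fundamental forms transform by congruence with the Jacobian of \<open>\<tau>\<close>, up to the sign by which
  the normal changes. So the numerator and the denominator of the formula for the mean curvature both pick up
  the square of the Jacobian determinant.\<close>

lemma mean_curvature_reparam:
  fixes \<tau> :: "real^2 \<Rightarrow> real^2" and u :: "real^2 \<Rightarrow> real^3"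
  assumes M: "open M" "C2_on M \<tau>" and u: "C2_on \<Omega> u" and y: "y \<in> M" "\<tau> ` M \<subseteq> \<Omega>"
    and imm: "cross3 (pd 1 (\<lambda>y. u (\<tau> y)) y) (pd 2 (\<lambda>y. u (\<tau> y)) y) \<noteq> 0"
  shows "mean_curvature (\<lambda>y. u (\<tau> y)) y = sgn (jacobian_det \<tau> y) * mean_curvature u (\<tau> y)"
proof -
  let ?w = "\<lambda>y. u (\<tau> y)"
  let ?d = "jacobian_det \<tau> y" and ?n = "unit_normal u (\<tau> y)"
  have dif: "\<tau> differentiable (at y)" "u differentiable (at (\<tau> y))"
    using M(2) u y by (auto simp: C2_on_def C1_on_def)
  note cross = cross_pd_chain[OF dif]
  have d0: "?d \<noteq> 0" and imm_u: "cross3 (pd 1 u (\<tau> y)) (pd 2 u (\<tau> y)) \<noteq> 0"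
    using imm by (auto simp: cross)
  have nw: "unit_normal ?w y = sgn ?d *\<^sub>R ?n"
    by (simp add: unit_normal_def cross sgn_scaleR)
  define J where "J i a = pd i \<tau> y $ a" for i a
  define B where "B b a = pd b (pd a u) (\<tau> y) \<bullet> ?n" for a b
  define E F G where EFG: "E = pd 1 u (\<tau> y) \<bullet> pd 1 u (\<tau> y)" "F = pd 1 u (\<tau> y) \<bullet> pd 2 u (\<tau> y)"
    "G = pd 2 u (\<tau> y) \<bullet> pd 2 u (\<tau> y)"
  have first: "pd i ?w y \<bullet> pd j ?w y =
      J i 1 * J j 1 * E + (J i 1 * J j 2 + J i 2 * J j 1) * F + J i 2 * J j 2 * G" for i j
    by (simp add: pd_chain_2[OF dif] EFG J_def inner_add_left inner_add_right
        inner_commute[of "pd 2 u (\<tau> y)" "pd 1 u (\<tau> y)"] algebra_simps)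
  have second: "pd i (pd j ?w) y \<bullet> unit_normal ?w y = sgn ?d *
      (J j 1 * J i 1 * B 1 1 + J j 1 * J i 2 * B 2 1 + J j 2 * J i 1 * B 1 2 + J j 2 * J i 2 * B 2 2)" for i j
    using second_pd_chain_normal[OF M u y unit_normal_orthogonal(2), of i j]
    by (simp add: nw B_def J_def sum_2 algebra_simps)
  have d: "?d = J 1 1 * J 2 2 - J 1 2 * J 2 1" by (simp add: jacobian_det_def J_def)
  have "mean_curvature ?w y = sgn ?d * (?d\<^sup>2 * (G * B 1 1 - F * (B 1 2 + B 2 1) + E * B 2 2))
      / (2 * (norm (?d *\<^sub>R cross3 (pd 1 u (\<tau> y)) (pd 2 u (\<tau> y))))\<^sup>2)"
    unfolding mean_curvature_eq[OF imm] cross first second d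
    by (intro arg_cong2[where f = "(/)"] refl) algebra
  also have "\<dots> = sgn ?d * ((G * B 1 1 - F * (B 1 2 + B 2 1) + E * B 2 2)
      / (2 * (norm (cross3 (pd 1 u (\<tau> y)) (pd 2 u (\<tau> y))))\<^sup>2))"
    using d0 by (simp add: power_mult_distrib)
  also have "\<dots> = sgn ?d * mean_curvature u (\<tau> y)"
    by (simp add: mean_curvature_eq[OF imm_u] EFG B_def)
  finally show ?thesis .
qed

text \<open>Minimality refers to all parametrizations, but any two of them differ by a \<open>C\<^sup>2\<close> transition map,
  which changes the mean curvature at most by a sign. So one parametrization around each point suffices.\<close>

lemma minimal_surfaceI:
  assumes "\<And>p. p \<in> S \<Longrightarrow> \<exists>\<Omega> u. local_param S \<Omega> u \<and> p \<in> u ` \<Omega> \<and> (\<forall>x\<in>\<Omega>. mean_curvature u x = 0)"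
  shows "minimal_surface S"
  unfolding minimal_surface_def
proof (intro allI impI ballI)
  fix \<Omega>' w y assume w: "local_param S \<Omega>' w" and y: "y \<in> \<Omega>'"
  then have "w y \<in> S" using local_paramD(3) openin_imp_subset by blast
  then obtain \<Omega> u where u: "local_param S \<Omega> u" and wy: "w y \<in> u ` \<Omega>"
    and H: "\<forall>x\<in>\<Omega>. mean_curvature u x = 0"
    using assms by blast
  obtain v where v: "homeomorphism \<Omega> (u ` \<Omega>) u v" using u by (auto simp: local_param_def)
  let ?M = "\<Omega>' \<inter> w -` (u ` \<Omega>)"
  note M = transition_map_C2[OF u v w]
  have uvw: "w z = u (v (w z))" and vw: "v (w z) \<in> \<Omega>" if "z \<in> ?M" for z
    using v that by (auto simp: homeomorphism_def)
  have yM: "y \<in> ?M" using y wy by blast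
  have pd_eq: "pd i w y = pd i (\<lambda>z. u (v (w z))) y" "pd i (pd j w) y = pd i (pd j (\<lambda>z. u (v (w z)))) y" for i j
    by (rule pd_cong[OF M(1) yM uvw] pd_pd_cong[OF M(1) yM uvw]; assumption)+
  have "mean_curvature w y = mean_curvature (\<lambda>z. u (v (w z))) y"
    unfolding mean_curvature_def first_fund_def second_fund_def unit_normal_def pd_eq ..
  also have "\<dots> = sgn (jacobian_det (\<lambda>z. v (w z)) y) * mean_curvature u (v (w y))"
    using local_paramD(4)[OF w y] vw
    by (intro mean_curvature_reparam[OF M local_paramD(2)[OF u] yM]) (auto simp: pd_eq[symmetric])
  finally show "mean_curvature w y = 0" using H vw[OF yM] by simp
qed

section \<open>Isothermal coordinates on minimal surfaces\<close>

lemma C1_on_unit_normal: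
  assumes "open \<Omega>" "C2_on \<Omega> u" "\<And>x. x \<in> \<Omega> \<Longrightarrow> cross3 (pd 1 u x) (pd 2 u x) \<noteq> 0"
  shows "C1_on \<Omega> (unit_normal u)"
proof -
  define c where "c x = cross3 (pd 1 u x) (pd 2 u x)" for x
  have c: "C1_on \<Omega> c"
    unfolding c_def[abs_def]
    by (intro C1_on_bilinear[OF _ bounded_bilinear_cross3] C2_on_C1_on_pd assms)
  have pos: "c x \<bullet> c x > 0" if "x \<in> \<Omega>" for x using assms(3)[OF that] by (simp add: c_def)
  have "C1_on \<Omega> (\<lambda>x. inverse (sqrt (c x \<bullet> c x)))"
  proof (rule C1_on_scalar[where \<phi> = "\<lambda>t. inverse (sqrt t)"
        and \<phi>' = "\<lambda>t. - (inverse (sqrt t) * (inverse (sqrt t) / 2) * inverse (sqrt t))"])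
    show "C1_on \<Omega> (\<lambda>x. c x \<bullet> c x)"
      by (intro C1_on_bilinear[OF _ bounded_bilinear_inner] c assms)
    show "((\<lambda>t. inverse (sqrt t)) has_real_derivative
        - (inverse (sqrt (c x \<bullet> c x)) * (inverse (sqrt (c x \<bullet> c x)) / 2) * inverse (sqrt (c x \<bullet> c x))))
        (at (c x \<bullet> c x))" if "x \<in> \<Omega>" for x
      using pos[OF that] by (intro DERIV_inverse' DERIV_real_sqrt) auto
    show "continuous_on ((\<lambda>x. c x \<bullet> c x) ` \<Omega>)
        (\<lambda>t. - (inverse (sqrt t) * (inverse (sqrt t) / 2) * inverse (sqrt t)))"
      by (intro continuous_intros) (use pos in force)+
  qed (rule assms)
  then have "C1_on \<Omega> (\<lambda>x. inverse (sqrt (c x \<bullet> c x)) *\<^sub>R c x)"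
    by (intro C1_on_bilinear[OF _ bounded_bilinear_scaleR] c assms)
  moreover have "unit_normal u = (\<lambda>x. inverse (sqrt (c x \<bullet> c x)) *\<^sub>R c x)"
    by (simp add: fun_eq_iff unit_normal_def c_def sgn_div_norm norm_eq_sqrt_inner)
  ultimately show ?thesis by simp
qed

lemma pd_unit_normal:
  assumes "open \<Omega>" "C2_on \<Omega> u" "\<And>x. x \<in> \<Omega> \<Longrightarrow> cross3 (pd 1 u x) (pd 2 u x) \<noteq> 0" "x \<in> \<Omega>"
  shows "pd i (unit_normal u) x \<bullet> unit_normal u x = 0"
    "pd i (unit_normal u) x \<bullet> pd j u x = - (pd i (pd j u) x \<bullet> unit_normal u x)"
proof -
  have dif: "unit_normal u differentiable (at x)" "pd j u differentiable (at x)"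
    using C1_on_unit_normal[OF assms(1-3)] C2_on_C1_on_pd[OF assms(2)] assms(4) by (auto simp: C1_on_def)
  have "pd i (\<lambda>x. unit_normal u x \<bullet> unit_normal u x) x = pd i (\<lambda>x. 1::real) x"
    by (rule pd_cong[OF assms(1,4)]) (use assms(3) unit_normal_unit in blast)
  then show "pd i (unit_normal u) x \<bullet> unit_normal u x = 0"
    by (simp add: pd_bilinear[OF bounded_bilinear_inner dif(1) dif(1)] inner_commute)
  have "pd i (\<lambda>x. unit_normal u x \<bullet> pd j u x) x = pd i (\<lambda>x. 0::real) x"
    by (simp add: unit_normal_orthogonal)
  then show "pd i (unit_normal u) x \<bullet> pd j u x = - (pd i (pd j u) x \<bullet> unit_normal u x)"
    by (simp add: pd_bilinear[OF bounded_bilinear_inner dif] inner_commute)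
qed

text \<open>Closedness of \<open>n \<times> du\<close>: the difference of the two sides is orthogonal to \<open>D\<^sub>1u\<close> and \<open>D\<^sub>2u\<close>,
  because the derivatives of \<open>n\<close> are tangent, and its product with \<open>D\<^sub>1u \<times> D\<^sub>2u\<close> is
  \<open>-2 \<bar>D\<^sub>1u \<times> D\<^sub>2u\<bar>\<^sup>2\<close> times the mean curvature.\<close>

lemma minimal_imp_normal_cross_closed:
  assumes "open \<Omega>" "C2_on \<Omega> u" "\<And>x. x \<in> \<Omega> \<Longrightarrow> cross3 (pd 1 u x) (pd 2 u x) \<noteq> 0" "x \<in> \<Omega>"
    and "mean_curvature u x = 0"
  shows "cross3 (pd 1 (unit_normal u) x) (pd 2 u x) = cross3 (pd 2 (unit_normal u) x) (pd 1 u x)"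
proof -
  let ?n = "unit_normal u x" and ?a = "pd 1 u x" and ?b = "pd 2 u x"
  let ?na = "pd 1 (unit_normal u) x" and ?nb = "pd 2 (unit_normal u) x"
  let ?z = "cross3 ?na ?b - cross3 ?nb ?a"
  have c: "cross3 ?a ?b \<noteq> 0" using assms by blast
  note dn = pd_unit_normal[OF assms(1-4)]
  have dn2: "pd i (unit_normal u) x \<bullet> pd j u x = - (pd i (pd j u) x \<bullet> ?n)" for i j
    by (rule dn(2))
  have n0: "?na \<bullet> cross3 ?a ?b = 0" "?nb \<bullet> cross3 ?a ?b = 0"
    by (subst cross_eq_unit_normal, simp add: dn)+
  have "?z = 0"
  proof (rule orthogonal_to_frame_imp_zero[OF c])
    have "?z \<bullet> ?a = - (?na \<bullet> cross3 ?a ?b)"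
      by (simp add: inner_diff_left dot_cross_self cross3_simps)
    then show "?z \<bullet> ?a = 0" by (simp add: n0)
    have "?z \<bullet> ?b = - (?nb \<bullet> cross3 ?a ?b)"
      by (simp add: cross3_simps)
    then show "?z \<bullet> ?b = 0" by (simp add: n0)
    have "?z \<bullet> cross3 ?a ?b = (?na \<bullet> ?a) * (?b \<bullet> ?b) - (?na \<bullet> ?b) * (?a \<bullet> ?b)
        - (?nb \<bullet> ?a) * (?a \<bullet> ?b) + (?nb \<bullet> ?b) * (?a \<bullet> ?a)"
      unfolding inner_diff_left dot_cross inner_commute[of ?b ?a] by simp
    also have "\<dots> = - (2 * (norm (cross3 ?a ?b))\<^sup>2 * mean_curvature u x)"
    proof -
      have "2 * (norm (cross3 ?a ?b))\<^sup>2 * mean_curvature u x =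
          (?b \<bullet> ?b) * (pd 1 (pd 1 u) x \<bullet> ?n)
          - (?a \<bullet> ?b) * (pd 1 (pd 2 u) x \<bullet> ?n + pd 2 (pd 1 u) x \<bullet> ?n)
          + (?a \<bullet> ?a) * (pd 2 (pd 2 u) x \<bullet> ?n)"
        using c by (simp add: mean_curvature_eq[OF c])
      then show ?thesis by (simp add: dn2 algebra_simps)
    qed
    finally show "?z \<bullet> cross3 ?a ?b = 0" by (simp add: assms(5))
  qed
  then show ?thesis by simp
qed

text \<open>The harmonic conjugate of the height function \<open>e \<bullet> u\<close> on a minimal surface. In the partial
  derivatives of the form \<open>e \<bullet> (n \<times> du)\<close> the second derivatives of \<open>u\<close> cancel by symmetry, and what
  remains is the previous lemma.\<close>

lemma minimal_conjugate_function:
  fixes e :: "real^3"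
  assumes u: "C2_on (ball a r) u" and imm: "\<And>x. x \<in> ball a r \<Longrightarrow> cross3 (pd 1 u x) (pd 2 u x) \<noteq> 0"
    and H: "\<And>x. x \<in> ball a r \<Longrightarrow> mean_curvature u x = 0"
  obtains \<eta> where "C2_on (ball a r) \<eta>"
    "\<forall>x\<in>ball a r. \<forall>i. pd i \<eta> x = cross3 e (unit_normal u x) \<bullet> pd i u x"
proof -
  let ?B = "ball a r"
  define m where "m x = cross3 e (unit_normal u x)" for x
  have bl: "bounded_linear (cross3 e)"
    by (rule bounded_bilinear.bounded_linear_right[OF bounded_bilinear_cross3])
  have C1n: "C1_on ?B (unit_normal u)" by (rule C1_on_unit_normal[OF open_ball u imm])
  have m: "C1_on ?B m" unfolding m_def[abs_def] by (rule C1_on_linear[OF open_ball bl C1n])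
  have C1: "C1_on ?B (\<lambda>x. m x \<bullet> pd i u x)" for i
    by (intro C1_on_bilinear[OF _ bounded_bilinear_inner] m C2_on_C1_on_pd u open_ball)
  have pdm: "pd j (\<lambda>x. m x \<bullet> pd i u x) x = m x \<bullet> pd j (pd i u) x + cross3 (pd j (unit_normal u) x) (pd i u x) \<bullet> e"
    if x: "x \<in> ?B" for i j x
  proof -
    have "m differentiable (at x)" "pd i u differentiable (at x)" "unit_normal u differentiable (at x)"
      using m C2_on_C1_on_pd[OF u] C1n x by (auto simp: C1_on_def)
    then show ?thesis
      using cross_triple[of e "pd j (unit_normal u) x" "pd i u x"]
      by (simp add: pd_bilinear[OF bounded_bilinear_inner] m_def[abs_def] pd_linear[OF bl])
  qed
  have closed: "pd 1 (\<lambda>x. m x \<bullet> pd 2 u x) x = pd 2 (\<lambda>x. m x \<bullet> pd 1 u x) x" if x: "x \<in> ?B" for x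
    using pd_commute[OF u open_ball x, of 1 2]
      minimal_imp_normal_cross_closed[OF open_ball u imm x H[OF x]]
    by (simp add: pdm[OF x])
  have "pd i (\<lambda>x. m x \<bullet> pd j u x) x = pd j (\<lambda>x. m x \<bullet> pd i u x) x" if "x \<in> ?B" for i j x
    using exhaust_2[of i] exhaust_2[of j] closed[OF that] by auto
  note exact = closed_form_exact_on_ball[of a r "\<lambda>i x. m x \<bullet> pd i u x", OF C1 this]
  obtain \<eta> where "C2_on ?B \<eta>" "\<forall>x\<in>?B. \<forall>i. pd i \<eta> x = m x \<bullet> pd i u x"
    by (rule exact)
  then show thesis using that by (simp add: m_def)
qed

text \<open>On the plane orthogonal to the unit vector \<open>n\<close>, the functionals \<open>e\<close> and \<open>e \<times> n\<close> are represented
  by the projection \<open>t\<close> of \<open>e\<close> and by \<open>t \<times> n\<close>. These are orthogonal of the same length, so together the two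
  functionals form a similarity of that plane onto \<open>\<real>\<^sup>2\<close> with ratio \<open>\<bar>t\<bar>\<close>, unless \<open>t = 0\<close>.\<close>

lemma rotated_projection_conformal:
  fixes e n v v' :: "real^3"
  assumes n: "n \<bullet> n = 1" and v: "v \<bullet> n = 0" "v' \<bullet> n = 0"
  shows "(e \<bullet> v) * (e \<bullet> v') + (cross3 e n \<bullet> v) * (cross3 e n \<bullet> v') = (e \<bullet> e - (e \<bullet> n)\<^sup>2) * (v \<bullet> v')"
proof -
  let ?t = "e - (e \<bullet> n) *\<^sub>R n" and ?m = "cross3 e n"
  have t: "?t \<bullet> n = 0" "?t \<bullet> v = e \<bullet> v" "?t \<bullet> v' = e \<bullet> v'" "cross3 ?t n = ?m"
    using n v by (simp_all add: inner_diff_left inner_commute[of n v] inner_commute[of n v'] Cross3.left_diff_distrib cross_mult_left)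
  have tt: "?t \<bullet> ?t = e \<bullet> e - (e \<bullet> n)\<^sup>2"
    using n by (simp add: inner_diff_left inner_diff_right inner_commute[of n e] power2_eq_square)
  have mm: "?m \<bullet> ?m = e \<bullet> e - (e \<bullet> n)\<^sup>2"
    unfolding dot_cross using n by (simp add: inner_commute[of n e] power2_eq_square)
  show ?thesis
  proof (cases "?m = 0")
    case True
    then have "?t \<bullet> ?t = 0" using mm tt by simp
    then have "?t = 0" by simp
    then have "e \<bullet> v = 0" "e \<bullet> v' = 0" using t(2,3) by simp_all
    then show ?thesis using True mm by simp
  next
    case False
    let ?z = "(?t \<bullet> ?t) *\<^sub>R v - (e \<bullet> v) *\<^sub>R ?t - (?m \<bullet> v) *\<^sub>R ?m"
    have mt: "?m \<bullet> ?t = 0" "?m \<bullet> n = 0" "?t \<bullet> ?m = 0"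
      unfolding t(4)[symmetric] by (simp_all add: dot_cross_self)
    have "?z = 0"
    proof (rule orthogonal_to_frame_imp_zero[of ?t n])
      show "cross3 ?t n \<noteq> 0" using False t(4) by simp
      show "?z \<bullet> ?t = 0"
        using t(2) by (simp only: inner_diff_left inner_scaleR_left mt inner_commute[of v e] inner_commute[of v ?t] inner_commute[of v ?m]) simp
      show "?z \<bullet> n = 0"
        using v(1) n by (simp only: inner_diff_left inner_scaleR_left mt) simp
      show "?z \<bullet> cross3 ?t n = 0"
        unfolding t(4) using mm tt mt(3)
        by (simp only: inner_diff_left inner_scaleR_left mt inner_commute[of v e] inner_commute[of v ?t] inner_commute[of v ?m]) simp
    qed
    then have "?z \<bullet> v' = 0" by simp
    then show ?thesis
      using t(3) tt by (simp only: inner_diff_left inner_scaleR_left)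
  qed
qed

text \<open>The pair \<open>\<theta> = (e \<bullet> w, \<eta>)\<close> of a height function and its conjugate is conformal by the previous lemma, and
  \<open>w\<close> composed with a local inverse of \<open>\<theta>\<close> is the isothermal parametrization.\<close>

theorem minimal_surface_isothermal_coordinates:
  assumes w: "local_param S \<Omega> w" and x0: "x0 \<in> \<Omega>"
    and H: "\<And>x. x \<in> \<Omega> \<Longrightarrow> mean_curvature w x = 0"
  obtains V u where "isothermal_param S V u" "w x0 \<in> u ` V"
proof -
  obtain r where r: "r > 0" "ball x0 r \<subseteq> \<Omega>" using local_paramD(1)[OF w] x0 openE by blast
  let ?B = "ball x0 r"
  have wB: "local_param S ?B w" using local_param_restrict[OF w open_ball r(2)] .
  note C2w = local_paramD(2)[OF wB] and imm = local_paramD(4)[OF wB] and dw = local_paramD(5)[OF wB]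
  define n where "n = unit_normal w"
  \<comment> \<open>Any \<open>e\<close> that is not normal to the surface at \<open>w x0\<close> works, so a tangent vector is a safe choice.\<close>
  define e where "e = pd 1 w x0"
  have HB: "mean_curvature w x = 0" if "x \<in> ?B" for x using that r(2) H by blast
  obtain \<eta> where \<eta>: "C2_on ?B \<eta>" "\<forall>x\<in>?B. \<forall>i. pd i \<eta> x = cross3 e (n x) \<bullet> pd i w x"
    unfolding n_def by (rule minimal_conjugate_function[OF C2w imm HB])
  define \<theta> :: "real^2 \<Rightarrow> real^2" where "\<theta> x = axis 1 (e \<bullet> w x) + axis 2 (\<eta> x)" for x
  have axis_lin: "bounded_linear (axis i :: real \<Rightarrow> real^2)" for i
    by (intro linear_conv_bounded_linear[THEN iffD1] linearI) (simp_all add: vec_eq_iff axis_def)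
  have "C2_on ?B (\<lambda>x. e \<bullet> w x)"
    by (rule C2_on_linear[OF open_ball bounded_linear_inner_right C2w])
  define \<theta>' :: "2 \<Rightarrow> real^2 \<Rightarrow> real^2" where "\<theta>' i x = axis 1 (e \<bullet> pd i w x) + axis 2 (cross3 e (n x) \<bullet> pd i w x)" for i x
  have C1': "C1_on ?B (\<theta>' i)" for i
  proof -
    have "C1_on ?B n" unfolding n_def by (rule C1_on_unit_normal[OF open_ball C2w imm])
    then have "C1_on ?B (\<lambda>x. cross3 e (n x))"
      by (rule C1_on_linear[OF open_ball bounded_bilinear.bounded_linear_right[OF bounded_bilinear_cross3]])
    then have "C1_on ?B (\<lambda>x. cross3 e (n x) \<bullet> pd i w x)"
      by (rule C1_on_bilinear[OF open_ball bounded_bilinear_inner _ C2_on_C1_on_pd[OF C2w]])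
    moreover have "C1_on ?B (\<lambda>x. e \<bullet> pd i w x)"
      by (rule C1_on_linear[OF open_ball bounded_linear_inner_right C2_on_C1_on_pd[OF C2w]])
    ultimately show ?thesis
      unfolding \<theta>'_def by (intro C1_on_add[OF open_ball] C1_on_linear[OF open_ball axis_lin])
  qed
  have der\<theta>: "(\<theta> has_derivative (\<lambda>h. \<Sum>i\<in>UNIV. (h $ i) *\<^sub>R \<theta>' i x)) (at x)" if x: "x \<in> ?B" for x
  proof -
    have "((\<lambda>x. e \<bullet> w x) has_derivative (\<lambda>h. e \<bullet> (\<Sum>i\<in>UNIV. (h $ i) *\<^sub>R pd i w x))) (at x)"
      by (rule bounded_linear.has_derivative[OF bounded_linear_inner_right has_derivative_pd[OF dw[OF x]]])
    from has_derivative_add[OF bounded_linear.has_derivative[OF axis_lin[of 1] this]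
        bounded_linear.has_derivative[OF axis_lin[of 2] C1_on_has_derivative[OF C2_on_imp_C1_on[OF \<eta>(1)] x]]]
    show ?thesis
      unfolding \<theta>_def \<theta>'_def
      by (rule has_derivative_eq_rhs)
        (use \<eta>(2) x in \<open>simp add: fun_eq_iff vec_eq_iff forall_2 sum_2 axis_def inner_add_right\<close>)
  qed
  have C2\<theta>: "C2_on ?B \<theta>" by (rule C2_onI[OF open_ball der\<theta> C1'])
  have pd\<theta>: "pd i \<theta> x = \<theta>' i x" if "x \<in> ?B" for i x
    by (rule C1_onI(2)[OF open_ball der\<theta> C1_on_continuous[OF C1'] that])
  have x0B: "x0 \<in> ?B" using r(1) by simp
  have "jacobian_det \<theta> x0 \<noteq> 0"
  proof -
    have "jacobian_det \<theta> x0 = (e \<bullet> pd 1 w x0) * (cross3 e (n x0) \<bullet> pd 2 w x0)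
        - (e \<bullet> pd 2 w x0) * (cross3 e (n x0) \<bullet> pd 1 w x0)"
      by (simp add: jacobian_det_def pd\<theta>[OF x0B] \<theta>'_def axis_def)
    also have "\<dots> = cross3 e (cross3 e (n x0)) \<bullet> cross3 (pd 1 w x0) (pd 2 w x0)"
      unfolding dot_cross by (simp add: algebra_simps)
    also have "\<dots> = - ((e \<bullet> e) * (n x0 \<bullet> cross3 (pd 1 w x0) (pd 2 w x0)))"
      by (simp add: Lagrange e_def n_def unit_normal_orthogonal)
    also have "\<dots> = - ((e \<bullet> e) * norm (cross3 (pd 1 w x0) (pd 2 w x0)))"
      using arg_cong[OF cross_eq_unit_normal[of w x0], of "\<lambda>z. n x0 \<bullet> z"]
      by (simp add: n_def unit_normal_unit[OF imm[OF x0B]])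
    finally show ?thesis using imm[OF x0B] by (auto simp: e_def)
  qed
  then obtain U V g where U: "open U" "U \<subseteq> ?B" "x0 \<in> U" "open V" "homeomorphism U V \<theta> g" "C2_on V g"
    using C2_inverse_function[OF open_ball C2\<theta> x0B] by metis
  have gV: "g ` V = U" "\<And>y. y \<in> V \<Longrightarrow> g y \<in> ?B" "\<And>y. y \<in> V \<Longrightarrow> \<theta> (g y) = y"
    using U(2,5) by (auto simp: homeomorphism_def)
  define u where "u y = w (g y)" for y
  have dg: "g differentiable (at y)" if "y \<in> V" for y
    using U(6) that by (auto simp: C2_on_def C1_on_def)
  \<comment> \<open>The equation \<open>\<theta> (g y) = y\<close>, differentiated.\<close>
  have coord: "axis i 1 = axis 1 (e \<bullet> pd i u y) + axis 2 (cross3 e (n (g y)) \<bullet> pd i u y)" if y: "y \<in> V" for i y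
  proof -
    have "pd i (\<lambda>y. \<theta> (g y)) y = pd i (\<lambda>y. y) y"
      by (rule pd_cong[OF U(4) y gV(3)])
    then have "axis i 1 = pd i (\<lambda>y. \<theta> (g y)) y" by (simp add: pd_eqI[OF has_derivative_ident])
    also have "\<dots> = (pd i g y $ 1) *\<^sub>R \<theta>' 1 (g y) + (pd i g y $ 2) *\<^sub>R \<theta>' 2 (g y)"
    proof -
      have "\<theta> differentiable (at (g y))" using der\<theta>[OF gV(2)[OF y]] differentiable_def by blast
      from pd_chain_2[OF dg[OF y] this] show ?thesis by (simp only: pd\<theta>[OF gV(2)[OF y]])
    qed
    also have "\<dots> = axis 1 (e \<bullet> pd i u y) + axis 2 (cross3 e (n (g y)) \<bullet> pd i u y)"
      unfolding u_def[abs_def] pd_chain_2[OF dg[OF y] dw[OF gV(2)[OF y]]] \<theta>'_def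
      by (simp add: vec_eq_iff forall_2 axis_def inner_add_right)
    finally show ?thesis .
  qed
  \<comment> \<open>The squared length of the tangential part of \<open>e\<close>, so the conformal factor of \<open>u\<close> is \<open>1 / sqrt \<rho>\<close>.\<close>
  define \<rho> where "\<rho> y = e \<bullet> e - (e \<bullet> n (g y))\<^sup>2" for y
  have metric: "\<rho> y * (pd i u y \<bullet> pd j u y) = (if i = j then 1 else 0)" if y: "y \<in> V" for i j y
  proof -
    have nn: "n (g y) \<bullet> n (g y) = 1"
      unfolding n_def by (rule unit_normal_unit[OF imm[OF gV(2)[OF y]]])
    have tangent: "pd k u y \<bullet> n (g y) = 0" for k
      unfolding u_def[abs_def] pd_chain_2[OF dg[OF y] dw[OF gV(2)[OF y]]] n_def
      by (simp add: inner_add_left unit_normal_orthogonal)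
    have c: "e \<bullet> pd k u y = axis k 1 $ 1" "cross3 e (n (g y)) \<bullet> pd k u y = axis k 1 $ 2" for k
      unfolding coord[OF y, of k] by (simp_all add: axis_def)
    show ?thesis
      using rotated_projection_conformal[OF nn tangent[of i] tangent[of j], of e] exhaust_2[of i] exhaust_2[of j]
      unfolding c \<rho>_def[symmetric] by (auto simp: axis_def)
  qed
  have \<rho>0: "\<rho> y \<noteq> 0" if "y \<in> V" for y using metric[OF that, of 1 1] by auto
  have orth: "pd 1 u y \<bullet> pd 2 u y = 0" and eq: "pd 2 u y \<bullet> pd 2 u y = pd 1 u y \<bullet> pd 1 u y"
    and ne: "pd 1 u y \<bullet> pd 1 u y \<noteq> 0" if "y \<in> V" for y
    using metric[OF that, of 1 2] metric[OF that, of 1 1] metric[OF that, of 2 2] \<rho>0[OF that]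
    by (auto simp: metric) (metis mult_left_cancel)
  have "local_param S V u"
    unfolding local_param_def
  proof (intro conjI ballI)
    show "open V" by fact
    show "C2_on V u" unfolding u_def[abs_def] by (rule C2_on_compose[OF U(4) C2w U(6)]) (use gV in blast)
    have wU: "local_param S U w" by (rule local_param_restrict[OF wB U(1,2)])
    have uV: "u ` V = w ` U" unfolding gV(1)[symmetric] u_def by auto
    show "openin (top_of_set S) (u ` V)" unfolding uV by (rule local_paramD(3)[OF wU])
    obtain w' where w': "homeomorphism U (w ` U) w w'" using wU by (auto simp: local_param_def)
    have "homeomorphism V (w ` U) (w \<circ> g) (\<theta> \<circ> w')"
      by (rule homeomorphism_compose[OF homeomorphism_symD[OF U(5)] w'])
    then show "\<exists>v. homeomorphism V (u ` V) u v" unfolding uV u_def comp_def by blast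
    show "rank (grad u y) = 2" if y: "y \<in> V" for y
      using orth[OF y] eq[OF y] ne[OF y] by (intro conformal_imp_rank_2) auto
  qed
  then have "isothermal_param S V u" by (rule isothermal_paramI) (use orth eq in blast)+
  moreover have "w x0 \<in> u ` V" using U(3) gV(1) unfolding u_def by blast
  ultimately show thesis using that by blast
qed

theorem minimal_iff_normal_atlas:
  assumes "C2_surface S"
  shows "minimal_surface S \<longleftrightarrow> has_isothermal_atlas S norm_inf_harmonic"
proof
  assume min: "minimal_surface S"
  show "has_isothermal_atlas S norm_inf_harmonic"
    unfolding has_isothermal_atlas_iff
  proof
    fix p assume "p \<in> S"
    then obtain \<Omega> w x where w: "local_param S \<Omega> w" "x \<in> \<Omega>" "p = w x"
      using assms unfolding C2_surface_def by blast
    have "\<And>x. x \<in> \<Omega> \<Longrightarrow> mean_curvature w x = 0" using min w(1) by (auto simp: minimal_surface_def)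
    then obtain V u where u: "isothermal_param S V u" "w x \<in> u ` V"
      by (rule minimal_surface_isothermal_coordinates[OF w(1,2)])
    have "norm_op u y = 0" if "y \<in> V" for y
      using mean_curvature_conformal[OF u(1) that] min isothermal_paramD(1)[OF u(1)] that
      unfolding minimal_surface_def by blast
    then have "norm_inf_harmonic V u"
      using local_paramD(1,2)[OF isothermal_paramD(1)[OF u(1)]] by (simp add: norm_inf_harmonic_def)
    then show "\<exists>\<Omega> u. isothermal_param S \<Omega> u \<and> norm_inf_harmonic \<Omega> u \<and> p \<in> u ` \<Omega>"
      using u w(3) by blast
  qed
next
  assume atlas: "has_isothermal_atlas S norm_inf_harmonic"
  show "minimal_surface S"
  proof (rule minimal_surfaceI)
    fix p assume "p \<in> S"
    then obtain \<Omega> u where u: "isothermal_param S \<Omega> u" "norm_inf_harmonic \<Omega> u" "p \<in> u ` \<Omega>"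
      using atlas unfolding has_isothermal_atlas_iff by blast
    then have "\<forall>x\<in>\<Omega>. mean_curvature u x = 0"
      using mean_curvature_conformal[OF u(1)] by (auto simp: norm_inf_harmonic_def)
    then show "\<exists>\<Omega> u. local_param S \<Omega> u \<and> p \<in> u ` \<Omega> \<and> (\<forall>x\<in>\<Omega>. mean_curvature u x = 0)"
      using u isothermal_paramD(1) by blast
  qed
qed

section \<open>Flat surfaces and tangentially harmonic parametrizations\<close>

text \<open>The left-hand side is half the derivative of \<open>\<bar>Du\<bar>\<^sup>2\<close>, and both columns of \<open>Du\<close> contribute the same
  amount to \<open>\<bar>Du\<bar>\<^sup>2\<close>.\<close>

lemma tang_op_conformal_factor:
  assumes u: "isothermal_param S \<Omega> u" and x: "x \<in> \<Omega>"
  shows "(\<Sum>j\<in>UNIV. pd i (pd j u) x \<bullet> pd j u x) = pd i (\<lambda>x. pd 1 u x \<bullet> pd 1 u x) x"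
proof -
  note p = isothermal_paramD[OF u] and lp = local_paramD[OF isothermal_paramD(1)[OF u]]
  have d: "pd i (\<lambda>x. pd j u x \<bullet> pd j u x) x = 2 * (pd i (pd j u) x \<bullet> pd j u x)" for j
    using pd_bilinear[OF bounded_bilinear_inner lp(6)[OF x] lp(6)[OF x]] by (simp add: inner_commute)
  have "pd i (\<lambda>x. pd 2 u x \<bullet> pd 2 u x) x = pd i (\<lambda>x. pd 1 u x \<bullet> pd 1 u x) x"
    by (rule pd_cong[OF lp(1) x p(3)])
  then show ?thesis by (simp add: sum_2 d)
qed

lemma tang_op_isothermal_eq_0_iff:
  assumes u: "isothermal_param S \<Omega> u" and x: "x \<in> \<Omega>"
  shows "tang_op u x = 0 \<longleftrightarrow> (\<forall>i. pd i (\<lambda>x. pd 1 u x \<bullet> pd 1 u x) x = 0)"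
  using tang_op_eq_0_iff[OF local_paramD(4)[OF isothermal_paramD(1)[OF u] x]]
  by (simp add: tang_op_conformal_factor[OF u x])

lemma conformal_factor_constant:
  assumes u: "isothermal_param S \<Omega> u" and B: "ball x0 r \<subseteq> \<Omega>" "x \<in> ball x0 r"
    and tang: "\<And>x. x \<in> \<Omega> \<Longrightarrow> tang_op u x = 0"
  shows "pd 1 u x \<bullet> pd 1 u x = pd 1 u x0 \<bullet> pd 1 u x0"
proof -
  let ?G = "\<lambda>x. pd 1 u x \<bullet> pd 1 u x"
  note lp = local_paramD[OF isothermal_paramD(1)[OF u]]
  have C1: "C1_on \<Omega> ?G"
    by (intro C1_on_bilinear[OF _ bounded_bilinear_inner] C2_on_C1_on_pd lp)
  have "(?G has_derivative (\<lambda>h. 0)) (at y within ball x0 r)" if "y \<in> ball x0 r" for y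
  proof -
    have "pd i ?G y = 0" for i
      using tang_op_isothermal_eq_0_iff[OF u, of y] tang[of y] that B(1) by blast
    then have "(?G has_derivative (\<lambda>h. 0)) (at y)"
      using C1_on_has_derivative[OF C1, of y] that B(1) by auto
    then show ?thesis by (rule has_derivative_at_withinI)
  qed
  then obtain c where "\<forall>y\<in>ball x0 r. ?G y = c"
    using has_derivative_zero_constant[of "ball x0 r" ?G] by blast
  moreover have "x0 \<in> ball x0 r" using B(2) by (auto intro: le_less_trans[OF zero_le_dist])
  ultimately show ?thesis using B(2) by metis
qed

lemma constant_factor_imp_tang_inf_harmonic:
  assumes u: "isothermal_param S \<Omega> u" and c: "\<And>x. x \<in> \<Omega> \<Longrightarrow> pd 1 u x \<bullet> pd 1 u x = c"
  shows "tang_inf_harmonic \<Omega> u"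
proof -
  note lp = local_paramD[OF isothermal_paramD(1)[OF u]]
  have "pd i (\<lambda>x. pd 1 u x \<bullet> pd 1 u x) x = pd i (\<lambda>x. c) x" if "x \<in> \<Omega>" for i x
    by (rule pd_cong[OF lp(1) that c])
  then show ?thesis
    using tang_op_isothermal_eq_0_iff[OF u] lp(1,2) by (simp add: tang_inf_harmonic_def)
qed

lemma continuous_on_locally:
  fixes f :: "'a::t2_space \<Rightarrow> 'b::topological_space"
  assumes "\<And>q. q \<in> U \<Longrightarrow> \<exists>T. openin (top_of_set U) T \<and> q \<in> T \<and> continuous_on T f"
  shows "continuous_on U f"
  unfolding continuous_on_eq_continuous_within
proof
  fix q assume "q \<in> U"
  then obtain T where T: "openin (top_of_set U) T" "q \<in> T" "continuous_on T f"
    using assms by blast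
  then obtain W where W: "open W" "T = U \<inter> W" by (auto simp: openin_open)
  then have "at q within U = at q within T"
    using T(2) by (intro at_within_nhd[of q W]) auto
  then show "continuous (at q within U) f"
    using T(2,3) by (simp add: continuous_on_eq_continuous_within)
qed

text \<open>The metric condition on \<open>\<phi>\<close> is stated through parametrizations \<open>u\<close> of the domain. Since
  \<open>u = \<phi>\<^sup>-\<^sup>1 \<circ> (\<phi> \<circ> u)\<close> is an immersion and \<open>D(\<phi> \<circ> u)\<close> is therefore invertible, the condition transfers to the columns of
  the gradient of \<open>\<phi>\<^sup>-\<^sup>1\<close>, which have length \<open>\<bar>c\<bar>\<close>. In particular \<open>c \<noteq> 0\<close> on a non-empty domain.\<close>

lemma plane_isometry_inverse_isothermal:
  assumes S: "C2_surface S" and U: "openin (top_of_set S) U"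
    and iso: "isometry_onto_plane_region c U V \<phi>"
  shows "isothermal_param S V (inv_into U \<phi>) \<and> tang_inf_harmonic V (inv_into U \<phi>)"
proof -
  define w where "w = inv_into U \<phi>"
  have V: "open V" and bij: "bij_betw \<phi> U V" and C2w: "C2_on V w"
    and isom: "\<And>\<Omega> u. local_param U \<Omega> u \<Longrightarrow> C2_on \<Omega> (\<phi> \<circ> u)"
      "\<And>\<Omega> u x h k. local_param U \<Omega> u \<Longrightarrow> x \<in> \<Omega> \<Longrightarrow>
        c\<^sup>2 * ((grad (\<phi> \<circ> u) x *v h) \<bullet> (grad (\<phi> \<circ> u) x *v k)) = (grad u x *v h) \<bullet> (grad u x *v k)"
    using iso by (auto simp: isometry_onto_plane_region_def w_def)
  have w\<phi>: "w (\<phi> q) = q" "\<phi> q \<in> V" if "q \<in> U" for q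
    using bij that by (auto simp: w_def bij_betw_def)
  have \<phi>w: "\<phi> (w y) = y" "w y \<in> U" if "y \<in> V" for y
    using bij that by (auto simp: w_def bij_betw_def f_inv_into_f inv_into_into)
  have wV: "w ` V = U" using w\<phi> \<phi>w by force
  have param: "\<exists>\<Omega> u x. local_param U \<Omega> u \<and> x \<in> \<Omega> \<and> u x = q" if "q \<in> U" for q
  proof -
    have "q \<in> S" using U that openin_imp_subset by blast
    then obtain \<Omega> u where "local_param S \<Omega> u" "q \<in> u ` \<Omega>"
      using S unfolding C2_surface_def by blast
    then obtain x where "local_param S \<Omega> u" "x \<in> \<Omega>" "u x = q" by blast
    then have "local_param U (\<Omega> \<inter> u -` U) u" "x \<in> \<Omega> \<inter> u -` U" "u x = q"
      using local_param_into_open_subset[OF _ U] that by auto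
    then show ?thesis by blast
  qed
  have cont_\<phi>: "continuous_on U \<phi>"
  proof (rule continuous_on_locally)
    fix q assume "q \<in> U"
    then obtain \<Omega> u x where u: "local_param U \<Omega> u" "x \<in> \<Omega>" "u x = q" using param by blast
    then obtain v where v: "homeomorphism \<Omega> (u ` \<Omega>) u v" by (auto simp: local_param_def)
    have "continuous_on (u ` \<Omega>) (\<lambda>p. (\<phi> \<circ> u) (v p))"
      using v by (intro continuous_on_compose2[OF C1_on_continuous[OF C2_on_imp_C1_on[OF isom(1)[OF u(1)]]]])
        (auto simp: homeomorphism_def)
    then have "continuous_on (u ` \<Omega>) \<phi>"
      by (rule continuous_on_eq) (use v in \<open>auto simp: homeomorphism_def\<close>)
    then show "\<exists>T. openin (top_of_set U) T \<and> q \<in> T \<and> continuous_on T \<phi>"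
      using local_paramD(3)[OF u(1)] u(2,3) by blast
  qed
  have metric: "(grad w y *v k) \<bullet> (grad w y *v l) = c\<^sup>2 * (k \<bullet> l)" and c0: "c \<noteq> 0" if y: "y \<in> V" for y k l
  proof -
    obtain \<Omega> u x where u: "local_param U \<Omega> u" "x \<in> \<Omega>" "u x = w y" using param \<phi>w(2)[OF y] by blast
    let ?\<theta> = "\<phi> \<circ> u"
    have uU: "u z \<in> U" if "z \<in> \<Omega>" for z using local_paramD(3)[OF u(1)] openin_imp_subset that by blast
    have \<theta>x: "?\<theta> x = y" using u(3) \<phi>w(1)[OF y] by simp
    have dif: "?\<theta> differentiable (at x)" "w differentiable (at (?\<theta> x))"
      unfolding \<theta>x using isom(1)[OF u(1)] u(2) C2w y by (auto simp: C2_on_def C1_on_def)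
    have Du: "grad u x *v h = grad w y *v (grad ?\<theta> x *v h)" for h
    proof -
      have "grad u x = grad (\<lambda>z. w (?\<theta> z)) x"
        by (rule grad_cong[OF local_paramD(1)[OF u(1)] u(2)]) (simp add: w\<phi>(1) uU)
      then show ?thesis by (simp only: grad_chain[OF dif] \<theta>x)
    qed
    have inj_u: "h = 0" if "grad u x *v h = 0" for h
    proof -
      have "inj ((*v) (grad u x))"
        using u(1,2) full_rank_injective[of "grad u x"] by (simp add: local_param_def)
      then show ?thesis using that linear_injective_0[OF matrix_vector_mul_linear] by blast
    qed
    show "c \<noteq> 0"
    proof
      assume "c = 0"
      then have "grad u x *v axis 1 1 = 0" using isom(2)[OF u(1,2), of "axis 1 1" "axis 1 1"] by simp
      from inj_u[OF this] show False by (simp add: axis_eq_0_iff)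
    qed
    have "inj ((*v) (grad ?\<theta> x))"
      using inj_u Du linear_injective_0[OF matrix_vector_mul_linear, of "grad ?\<theta> x"]
      by (metis matrix_vector_mult_0_right)
    then have "surj ((*v) (grad ?\<theta> x))"
      using linear_injective_imp_surjective[OF matrix_vector_mul_linear] by blast
    then obtain h h' where "k = grad ?\<theta> x *v h" "l = grad ?\<theta> x *v h'" by (metis surjD)
    then show "(grad w y *v k) \<bullet> (grad w y *v l) = c\<^sup>2 * (k \<bullet> l)"
      using isom(2)[OF u(1,2), of h h'] by (simp add: Du)
  qed
  have pd_w: "pd i w y \<bullet> pd j w y = (if i = j then c\<^sup>2 else 0)" if y: "y \<in> V" for i j y
  proof -
    have "grad w y *v axis i 1 = pd i w y" for i
      by (simp add: vec_eq_iff matrix_vector_mult_basis column_def grad_nth)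
    then show ?thesis using metric[OF y, of "axis i 1" "axis j 1"] by (simp add: inner_axis_axis)
  qed
  have "local_param S V w"
    unfolding local_param_def
  proof (intro conjI ballI V C2w)
    show "openin (top_of_set S) (w ` V)" using wV U by simp
    have "homeomorphism V U w \<phi>"
      unfolding homeomorphism_def
      using C1_on_continuous[OF C2_on_imp_C1_on[OF C2w]] cont_\<phi> wV w\<phi> \<phi>w bij
      by (auto simp: bij_betw_def)
    then show "\<exists>v. homeomorphism V (w ` V) w v" using wV by blast
    show "rank (grad w y) = 2" if "y \<in> V" for y
    proof (rule conformal_imp_rank_2)
      show "pd 1 w y \<noteq> 0" using pd_w[OF that, of 1 1] c0[OF that] by auto
    qed (simp_all add: pd_w[OF that])
  qed
  then have iso_w: "isothermal_param S V w" by (rule isothermal_paramI) (simp_all add: pd_w)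
  then show ?thesis
    using constant_factor_imp_tang_inf_harmonic[OF iso_w, of "c\<^sup>2"] by (simp add: pd_w flip: w_def)
qed

text \<open>The isometry is \<open>l u\<^sup>-\<^sup>1\<close>. For another parametrization \<open>u'\<close> its composition with \<open>u'\<close> is \<open>l\<close> times a
  transition map, which gives both the regularity and the metric condition.\<close>

lemma constant_factor_imp_isometry:
  assumes u: "isothermal_param S \<Omega> u" and L: "l > 0" "\<And>x. x \<in> \<Omega> \<Longrightarrow> pd 1 u x \<bullet> pd 1 u x = l\<^sup>2"
  obtains V \<phi> where "isometry_onto_plane_region 1 (u ` \<Omega>) V \<phi>"
proof -
  note lp = isothermal_paramD(1)[OF u]
  obtain v where v: "homeomorphism \<Omega> (u ` \<Omega>) u v" using lp by (auto simp: local_param_def)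
  have vu: "v (u x) = x" if "x \<in> \<Omega>" for x using v that by (auto simp: homeomorphism_def)
  let ?U = "u ` \<Omega>" and ?V = "(\<lambda>x. l *\<^sub>R x) ` \<Omega>" and ?\<phi> = "\<lambda>p. l *\<^sub>R v p"
  have V: "open ?V" using open_scaling[of l \<Omega>] L(1) local_paramD(1)[OF lp] by simp
  have bij: "bij_betw ?\<phi> ?U ?V"
  proof (rule bij_betw_imageI)
    show "inj_on ?\<phi> ?U" using L(1) vu by (auto intro!: inj_onI)
    show "?\<phi> ` ?U = ?V" using vu by (force simp: image_image)
  qed
  have inv: "inv_into ?U ?\<phi> y = u (inverse l *\<^sub>R y)" "inverse l *\<^sub>R y \<in> \<Omega>" if y: "y \<in> ?V" for y
  proof -
    obtain x where x: "x \<in> \<Omega>" "y = l *\<^sub>R x" using y by blast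
    then have "inv_into ?U ?\<phi> (?\<phi> (u x)) = u x"
      using bij by (intro inv_into_f_f) (auto simp: bij_betw_def)
    then show "inv_into ?U ?\<phi> y = u (inverse l *\<^sub>R y)" "inverse l *\<^sub>R y \<in> \<Omega>"
      using x L(1) by (simp_all add: vu)
  qed
  have "C2_on ?V (\<lambda>y. u (inverse l *\<^sub>R y))"
    by (rule C2_on_compose[OF V local_paramD(2)[OF lp] C2_on_linear[OF V bounded_linear_scaleR_right C2_on_ident[OF V]]])
      (use inv(2) in blast)
  then have C2inv: "C2_on ?V (inv_into ?U ?\<phi>)" by (rule C2_on_cong[OF V]) (rule inv(1))
  have "C2_on \<Omega>' (?\<phi> \<circ> u') \<and> (\<forall>x\<in>\<Omega>'. \<forall>h k. 1\<^sup>2 * ((grad (?\<phi> \<circ> u') x *v h) \<bullet> (grad (?\<phi> \<circ> u') x *v k)) =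
      (grad u' x *v h) \<bullet> (grad u' x *v k))" if u': "local_param ?U \<Omega>' u'" for \<Omega>' u'
  proof -
    let ?\<tau> = "\<lambda>y. v (u' y)"
    have u'U: "u' ` \<Omega>' \<subseteq> ?U" using local_paramD(3)[OF u'] openin_imp_subset by blast
    then have M: "\<Omega>' \<inter> u' -` ?U = \<Omega>'" by blast
    have lpU: "local_param ?U \<Omega> u" using local_param_open_subset[OF local_paramD(3)[OF lp], of u \<Omega>] lp by blast
    have open': "open \<Omega>'" by (rule local_paramD(1)[OF u'])
    have C2\<tau>: "C2_on \<Omega>' ?\<tau>" using transition_map_C2(2)[OF lpU v u'] by (simp only: M)
    have "C2_on \<Omega>' (?\<phi> \<circ> u')"
      using C2_on_linear[OF open' bounded_linear_scaleR_right C2\<tau>, of l] by (simp add: comp_def)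
    moreover have "1\<^sup>2 * ((grad (?\<phi> \<circ> u') x *v h) \<bullet> (grad (?\<phi> \<circ> u') x *v k)) =
      (grad u' x *v h) \<bullet> (grad u' x *v k)" if x: "x \<in> \<Omega>'" for x h k
    proof -
      have \<tau>x: "?\<tau> x \<in> \<Omega>" and uv: "\<And>z. z \<in> \<Omega>' \<Longrightarrow> u' z = u (?\<tau> z)"
        using u'U x v by (auto simp: homeomorphism_def)
      have dif: "?\<tau> differentiable (at x)" "u differentiable (at (?\<tau> x))"
        using C2\<tau> x local_paramD(5)[OF lp \<tau>x] by (auto simp: C2_on_def C1_on_def)
      have "grad u' x = grad (\<lambda>z. u (?\<tau> z)) x" by (rule grad_cong[OF open' x uv])
      then have Du': "grad u' x *v h = grad u (?\<tau> x) *v (grad ?\<tau> x *v h)" for h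
        by (simp only: grad_chain[OF dif])
      have D\<phi>: "grad (?\<phi> \<circ> u') x *v h = l *\<^sub>R (grad ?\<tau> x *v h)" for h
        by (simp add: grad_mult_eq comp_def pd_linear[OF bounded_linear_scaleR_right dif(1)] scaleR_add_right mult.commute)
      show ?thesis
        unfolding Du' D\<phi> conformal_inner_grad[OF isothermal_paramD(2)[OF u \<tau>x] isothermal_paramD(3)[OF u \<tau>x]] L(2)[OF \<tau>x]
        by (simp add: power2_eq_square)
    qed
    ultimately show ?thesis by blast
  qed
  then have "isometry_onto_plane_region 1 ?U ?V ?\<phi>"
    unfolding isometry_onto_plane_region_def using V bij C2inv by blast
  then show thesis by (rule that)
qed

theorem locally_flat_iff_tangential_atlas:
  assumes "C2_surface S"
  shows "(\<exists>c. locally_isometric_to_plane S c) \<longleftrightarrow> has_isothermal_atlas S tang_inf_harmonic"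
proof
  assume "\<exists>c. locally_isometric_to_plane S c"
  then obtain c where c: "locally_isometric_to_plane S c" ..
  show "has_isothermal_atlas S tang_inf_harmonic"
    unfolding has_isothermal_atlas_iff
  proof
    fix p assume "p \<in> S"
    then obtain U V \<phi> where U: "p \<in> U" "openin (top_of_set S) U" "isometry_onto_plane_region c U V \<phi>"
      using c unfolding locally_isometric_to_plane_def by blast
    moreover have "p \<in> inv_into U \<phi> ` V"
    proof -
      have "bij_betw \<phi> U V" using U(3) by (simp add: isometry_onto_plane_region_def)
      then have "\<phi> p \<in> V" "inv_into U \<phi> (\<phi> p) = p"
        using U(1) by (auto simp: bij_betw_def)
      then show ?thesis by (metis image_eqI)
    qed
    ultimately show "\<exists>\<Omega> u. isothermal_param S \<Omega> u \<and> tang_inf_harmonic \<Omega> u \<and> p \<in> u ` \<Omega>"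
      using plane_isometry_inverse_isothermal[OF assms, of U c V \<phi>] by blast
  qed
next
  assume atlas: "has_isothermal_atlas S tang_inf_harmonic"
  have "locally_isometric_to_plane S 1"
    unfolding locally_isometric_to_plane_def
  proof
    fix p assume "p \<in> S"
    then obtain \<Omega> u x0 where u: "isothermal_param S \<Omega> u" "tang_inf_harmonic \<Omega> u" "x0 \<in> \<Omega>" "p = u x0"
      using atlas unfolding has_isothermal_atlas_iff by blast
    note lp = isothermal_paramD(1)[OF u(1)]
    obtain r where r: "r > 0" "ball x0 r \<subseteq> \<Omega>" using local_paramD(1)[OF lp] u(3) openE by blast
    have tang: "tang_op u x = 0" if "x \<in> \<Omega>" for x using u(2) that by (simp add: tang_inf_harmonic_def)
    have lpB: "local_param S (ball x0 r) u" by (rule local_param_restrict[OF lp open_ball r(2)])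
    have uB: "isothermal_param S (ball x0 r) u"
      by (rule isothermal_paramI[OF lpB]) (use isothermal_paramD(2,3)[OF u(1)] r(2) in blast)+
    have "norm (pd 1 u x0) > 0" using local_paramD(4)[OF lp u(3)] by auto
    moreover have "pd 1 u x \<bullet> pd 1 u x = (norm (pd 1 u x0))\<^sup>2" if "x \<in> ball x0 r" for x
      using conformal_factor_constant[OF u(1) r(2) that tang] by (simp add: power2_norm_eq_inner)
    ultimately obtain V \<phi> where "isometry_onto_plane_region 1 (u ` ball x0 r) V \<phi>"
      by (rule constant_factor_imp_isometry[OF uB])
    moreover have "p \<in> u ` ball x0 r" using u(4) r(1) by simp
    ultimately show "\<exists>U V \<phi>. p \<in> U \<and> openin (top_of_set S) U \<and> isometry_onto_plane_region 1 U V \<phi>"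
      using local_paramD(3)[OF lpB] by blast
  qed
  then show "\<exists>c. locally_isometric_to_plane S c" ..
qed

section \<open>Planar surfaces\<close>

text \<open>Euclidean coordinates of a plane in space, from an orthonormal basis of its direction space.\<close>

lemma affine_plane_isometric_chart:
  fixes P :: "(real^3) set"
  assumes P: "affine P" "aff_dim P = 2"
  obtains a e1 e2 :: "real^3"
  where "e1 \<bullet> e1 = 1" "e2 \<bullet> e2 = 1" "e1 \<bullet> e2 = 0"
    "P = range (\<lambda>x::real^2. a + x $ 1 *\<^sub>R e1 + x $ 2 *\<^sub>R e2)"
proof -
  have "P \<noteq> {}" using P(2) by auto
  then obtain a where a: "a \<in> P" by blast
  define T where "T = (\<lambda>x. (-a) + x) ` P"
  have T: "subspace T" unfolding T_def by (rule affine_diffs_subspace[OF P(1) a])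
  have "aff_dim T = 2" unfolding T_def using P(2) aff_dim_translation_eq[of "-a" P] by simp
  then have "dim T = 2" using aff_dim_subspace[OF T] by simp
  then obtain B where B: "pairwise orthogonal B" "\<And>x. x \<in> B \<Longrightarrow> norm x = 1" "card B = 2" "span B = T"
    using orthonormal_basis_subspace[OF T] by metis
  obtain e1 e2 where e: "B = {e1, e2}" "e1 \<noteq> e2" using B(3) by (meson card_2_iff)
  have on: "e1 \<bullet> e1 = 1" "e2 \<bullet> e2 = 1" "e1 \<bullet> e2 = 0"
    using B(1,2) e by (auto simp: norm_eq_1 pairwise_def orthogonal_def)
  have "P = range (\<lambda>x::real^2. a + x $ 1 *\<^sub>R e1 + x $ 2 *\<^sub>R e2)" (is "P = range ?E")
  proof (intro set_eqI iffI)
    fix p assume "p \<in> P"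
    then have "p - a \<in> span {e1, e2}" unfolding e(1)[symmetric] B(4) T_def by force
    then obtain c where "(p - a) - c *\<^sub>R e1 \<in> span {e2}" using span_breakdown_eq by blast
    then obtain d where "(p - a) - c *\<^sub>R e1 = d *\<^sub>R e2" by (auto simp: span_singleton)
    then have "p = ?E (vector [c, d])" by (simp add: vector_2 algebra_simps)
    then show "p \<in> range ?E" by blast
  next
    fix p assume "p \<in> range ?E"
    then obtain x :: "real^2" where x: "p = ?E x" by blast
    have "x $ 1 *\<^sub>R e1 + x $ 2 *\<^sub>R e2 \<in> span B"
      unfolding e by (intro span_add span_scale span_base) auto
    then have "x $ 1 *\<^sub>R e1 + x $ 2 *\<^sub>R e2 \<in> T" using B(4) by simp
    then show "p \<in> P" unfolding T_def x by (auto simp: algebra_simps)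
  qed
  with on show thesis by (rule that)
qed

text \<open>The restriction of Euclidean coordinates of the plane to the surface is a single chart that forms the
  atlas. Its domain is open by invariance of domain: composing any parametrization of the surface with
  the coordinates gives a continuous injective map between planar domains.\<close>

lemma planar_surface_has_atlas:
  assumes S: "C2_surface S" and P: "affine P" "aff_dim P = 2" "S \<subseteq> P"
  shows "has_isothermal_atlas S inf_harmonic"
proof -
  obtain a e1 e2 where on: "e1 \<bullet> e1 = 1" "e2 \<bullet> e2 = 1" "e1 \<bullet> e2 = 0"
    and PE: "P = range (\<lambda>x::real^2. a + x $ 1 *\<^sub>R e1 + x $ 2 *\<^sub>R e2)"
    by (rule affine_plane_isometric_chart[OF P(1,2)])
  define E :: "real^2 \<Rightarrow> real^3" where "E x = a + x $ 1 *\<^sub>R e1 + x $ 2 *\<^sub>R e2" for x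
  define F :: "real^3 \<Rightarrow> real^2" where "F p = vector [(p - a) \<bullet> e1, (p - a) \<bullet> e2]" for p
  have FE: "F (E x) = x" for x
    using on by (simp add: F_def E_def vec_eq_iff forall_2 vector_2 inner_add_left inner_commute[of e2 e1])
  have EF: "E (F p) = p" if p: "p \<in> P" for p
  proof -
    obtain x where "p = E x" using p PE unfolding E_def by blast
    then show ?thesis by (simp add: FE)
  qed
  have "continuous_on UNIV (\<lambda>p. ((p - a) \<bullet> e1) *\<^sub>R axis 1 1 + ((p - a) \<bullet> e2) *\<^sub>R (axis 2 1 :: real^2))"
    by (intro continuous_intros)
  moreover have "F = (\<lambda>p. ((p - a) \<bullet> e1) *\<^sub>R axis 1 1 + ((p - a) \<bullet> e2) *\<^sub>R axis 2 1)"
    by (simp add: F_def fun_eq_iff vec_eq_iff forall_2 axis_def vector_2)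
  ultimately have contF: "continuous_on A F" for A using continuous_on_subset by fastforce
  have contE: "continuous_on A E" for A unfolding E_def by (intro continuous_intros)
  have injF: "inj_on F P" using EF by (metis inj_on_inverseI)
  define \<Omega> where "\<Omega> = E -` S"
  have "P = range E" using PE by (simp add: E_def[abs_def])
  then have E\<Omega>: "E ` \<Omega> = S" using P(3) by (auto simp: \<Omega>_def image_vimage_eq)
  have "open \<Omega>"
  proof (subst open_subopen, intro ballI)
    fix x assume "x \<in> \<Omega>"
    then have "E x \<in> S" by (simp add: \<Omega>_def)
    then obtain \<Omega>' w where w: "local_param S \<Omega>' w" "E x \<in> w ` \<Omega>'"
      using S unfolding C2_surface_def by blast
    then obtain y where y: "y \<in> \<Omega>'" "w y = E x" by force
    have wS: "w ` \<Omega>' \<subseteq> S" using local_paramD(3)[OF w(1)] openin_imp_subset by blast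
    have "continuous_on \<Omega>' (\<lambda>y. F (w y))"
      using C1_on_continuous[OF C2_on_imp_C1_on[OF local_paramD(2)[OF w(1)]]]
      by (intro continuous_on_compose2[OF contF]) auto
    moreover have "inj_on (\<lambda>y. F (w y)) \<Omega>'"
    proof -
      have "inj_on w \<Omega>'" using w(1) unfolding local_param_def homeomorphism_def by (metis inj_on_inverseI)
      moreover have "inj_on F (w ` \<Omega>')" using injF wS P(3) inj_on_subset by (metis order_trans)
      ultimately show ?thesis using comp_inj_on[of w \<Omega>' F] by (simp add: comp_def)
    qed
    ultimately have "open ((\<lambda>y. F (w y)) ` \<Omega>')"
      using invariance_of_domain local_paramD(1)[OF w(1)] by blast
    moreover have "x \<in> (\<lambda>y. F (w y)) ` \<Omega>'" using y FE by (metis image_eqI)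
    moreover have "(\<lambda>y. F (w y)) ` \<Omega>' \<subseteq> \<Omega>" using wS EF P(3) by (force simp: \<Omega>_def)
    ultimately show "\<exists>T. open T \<and> x \<in> T \<and> T \<subseteq> \<Omega>" by blast
  qed
  define e where "e i = (if i = 1 then e1 else e2)" for i :: 2
  have derE: "(E has_derivative (\<lambda>h. \<Sum>i\<in>UNIV. (h $ i) *\<^sub>R e i)) (at x)" for x
    unfolding E_def sum_2 e_def
    by (auto intro!: derivative_eq_intros bounded_linear.has_derivative[OF bounded_linear_vec_nth] simp: fun_eq_iff)
  have pdE: "pd i E = (\<lambda>x. e i)" for i
    using C1_onI(2)[of UNIV E "\<lambda>i x. e i"] derE by (auto simp: fun_eq_iff)
  have lp: "local_param S \<Omega> E"
    unfolding local_param_def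
  proof (intro conjI ballI)
    show "C2_on \<Omega> E" by (rule C2_onI[OF \<open>open \<Omega>\<close> derE C1_on_const])
    show "openin (top_of_set S) (E ` \<Omega>)" by (simp add: E\<Omega>)
    show "\<exists>v. homeomorphism \<Omega> (E ` \<Omega>) E v"
      using FE by (intro exI[of _ F]) (auto simp: homeomorphism_def contE contF image_image)
    show "rank (grad E x) = 2" for x
      by (rule conformal_imp_rank_2) (use on in \<open>auto simp: pdE e_def\<close>)
  qed fact
  have "isothermal_param S \<Omega> E"
    by (rule isothermal_paramI[OF lp]) (simp_all add: pdE e_def on)
  moreover have "inf_harmonic \<Omega> E"
    using local_paramD(1,2,4)[OF lp]
    by (simp add: inf_harmonic_def tang_op_eq norm_op_eq laplacian_def pdE)
  ultimately show ?thesis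
    unfolding has_isothermal_atlas_iff using E\<Omega> by blast
qed

lemma inf_harmonic_splits:
  assumes c: "cross3 (pd 1 u x) (pd 2 u x) \<noteq> 0" and "tang_op u x + norm_op u x = 0"
  shows "tang_op u x = 0" "norm_op u x = 0"
proof -
  have "tang_op u x \<bullet> unit_normal u x = 0"
    by (simp add: tang_op_eq inner_sum_left unit_normal_orthogonal)
  moreover have "tang_op u x = - norm_op u x" using assms(2) by (simp add: add_eq_0_iff)
  ultimately show "norm_op u x = 0"
    by (simp add: norm_op_eq[OF c] unit_normal_unit[OF c])
  then show "tang_op u x = 0" using assms(2) by simp
qed

text \<open>As the tangential part vanishes, the conformal factor is stationary at \<open>x\<close>. Differentiating the three
  components of the metric at such a point gives \<open>\<Delta>u \<bullet> D\<^sub>ku = 0\<close>, and the normal operator gives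
  \<open>\<Delta>u \<bullet> n = 0\<close>.\<close>

lemma inf_harmonic_isothermal_imp_laplacian_0:
  assumes u: "isothermal_param S \<Omega> u" and x: "x \<in> \<Omega>"
    and h: "tang_op u x + norm_op u x = 0"
  shows "laplacian u x = 0"
proof -
  note lp = local_paramD[OF isothermal_paramD(1)[OF u]]
  note split = inf_harmonic_splits[OF lp(4)[OF x] h]
  let ?a = "\<lambda>i j. pd i (pd j u) x"
  have tang: "pd i (\<lambda>x. pd 1 u x \<bullet> pd 1 u x) x = 0" for i
    using split(1) tang_op_isothermal_eq_0_iff[OF u x] by blast
  have "pd i (\<lambda>x. pd 2 u x \<bullet> pd 2 u x) x = 0" for i
    using pd_cong[OF lp(1) x isothermal_paramD(3)[OF u], where i = i] tang[of i] by simp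
  then have diag: "?a i 1 \<bullet> pd 1 u x = 0" "?a i 2 \<bullet> pd 2 u x = 0" for i
    using tang[of i] by (simp_all add: pd_bilinear[OF bounded_bilinear_inner lp(6)[OF x] lp(6)[OF x]] inner_commute)
  have "pd i (\<lambda>x. pd 1 u x \<bullet> pd 2 u x) x = pd i (\<lambda>x. 0) x" for i
    by (rule pd_cong[OF lp(1) x isothermal_paramD(2)[OF u]])
  then have off: "pd 1 u x \<bullet> ?a i 2 + ?a i 1 \<bullet> pd 2 u x = 0" for i
    by (simp add: pd_bilinear[OF bounded_bilinear_inner lp(6)[OF x] lp(6)[OF x]])
  have comm: "?a 2 1 = ?a 1 2" by (rule pd_commute[OF lp(2,1) x])
  have "laplacian u x \<bullet> pd 1 u x = 0" "laplacian u x \<bullet> pd 2 u x = 0"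
    using diag[of 1] diag[of 2] off[of 1] off[of 2]
    by (simp_all add: laplacian_def sum_2 inner_add_left comm inner_commute[of "pd 1 u x"])
  moreover have "laplacian u x \<bullet> cross3 (pd 1 u x) (pd 2 u x) = 0"
    using split(2) unfolding norm_op_eq_0_iff[OF lp(4)[OF x]]
    by (subst cross_eq_unit_normal) simp
  ultimately show ?thesis by (rule orthogonal_to_frame_imp_zero[OF lp(4)[OF x]])
qed

text \<open>Harmonicity and symmetry of the second derivatives are the Cauchy-Riemann equations for
  \<open>\<phi> = D\<^sub>1u - \<i> D\<^sub>2u\<close>. The function \<open>g\<close> is the product \<open>\<phi> \<bullet> \<phi>\<^sup>*\<close> of \<open>\<phi>\<close> with the constant conjugate
  vector \<open>\<phi>\<^sup>* = A + \<i> B\<close> taken at \<open>x0\<close>. By Cauchy-Schwarz and the constant lengths, \<open>Re g\<close> is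
  maximal at the centre, so \<open>\<bar>exp g\<bar>\<close> is constant. Equality in Cauchy-Schwarz then
  forces \<open>\<phi>\<close> to keep its value at \<open>x0\<close>.\<close>

lemma harmonic_constant_speed_imp_constant_gradient:
  fixes u :: "real^2 \<Rightarrow> real^3"
  assumes C2: "C2_on (ball x0 r) u"
    and lap: "\<And>x. x \<in> ball x0 r \<Longrightarrow> laplacian u x = 0"
    and speed: "\<And>x i. x \<in> ball x0 r \<Longrightarrow> norm (pd i u x) = l"
    and x: "x \<in> ball x0 r"
  shows "pd i u x = pd i u x0"
proof -
  let ?B = "ball x0 r"
  have r: "r > 0" using x by (auto intro: le_less_trans[OF zero_le_dist])
  then have x0: "x0 \<in> ?B" by simp
  \<comment> \<open>Complex coordinates on the disc, centred at \<open>x0\<close>.\<close>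
  define \<gamma> :: "complex \<Rightarrow> real^2" where "\<gamma> z = x0 + Re z *\<^sub>R axis 1 1 + Im z *\<^sub>R axis 2 1" for z
  have \<gamma>B: "\<gamma> z \<in> ?B" if "z \<in> ball 0 r" for z
    using that by (simp add: \<gamma>_def dist_norm norm_vec_def L2_set_def sum_2 axis_def cmod_def algebra_simps)
  define p where "p i = pd i u" for i
  define A B where "A = p 1 x0" and "B = p 2 x0"
  define g where "g z = Complex (p 1 (\<gamma> z) \<bullet> A + p 2 (\<gamma> z) \<bullet> B) (p 1 (\<gamma> z) \<bullet> B - p 2 (\<gamma> z) \<bullet> A)" for z
  have C1p: "C1_on ?B (p i)" for i unfolding p_def using C2 by (rule C2_on_C1_on_pd)
  have derg: "(g has_field_derivative
      Complex (pd 1 (p 1) (\<gamma> z) \<bullet> A + pd 1 (p 2) (\<gamma> z) \<bullet> B) (pd 1 (p 1) (\<gamma> z) \<bullet> B - pd 1 (p 2) (\<gamma> z) \<bullet> A)) (at z)"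
    if z: "z \<in> ball 0 r" for z
  proof -
    have "(\<gamma> has_derivative (\<lambda>h. Re h *\<^sub>R axis 1 1 + Im h *\<^sub>R axis 2 1)) (at z)"
      unfolding \<gamma>_def by (auto intro!: derivative_eq_intros)
    from has_derivative_compose[OF this C1_on_has_derivative[OF C1p \<gamma>B[OF z]]]
    have dp: "((\<lambda>z. p i (\<gamma> z)) has_derivative (\<lambda>h. Re h *\<^sub>R pd 1 (p i) (\<gamma> z) + Im h *\<^sub>R pd 2 (p i) (\<gamma> z))) (at z)" for i
      by (simp add: sum_2 axis_def)
    have lap': "pd 2 (p 2) (\<gamma> z) = - pd 1 (p 1) (\<gamma> z)"
      using lap[OF \<gamma>B[OF z]] by (simp add: laplacian_def sum_2 p_def add_eq_0_iff)
    have comm: "pd 2 (p 1) (\<gamma> z) = pd 1 (p 2) (\<gamma> z)"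
      unfolding p_def by (rule pd_commute[OF C2 open_ball \<gamma>B[OF z]])
    have g_eq: "g = (\<lambda>z. of_real (p 1 (\<gamma> z) \<bullet> A + p 2 (\<gamma> z) \<bullet> B) + \<i> * of_real (p 1 (\<gamma> z) \<bullet> B - p 2 (\<gamma> z) \<bullet> A))"
      by (simp add: fun_eq_iff g_def complex_eq_iff)
    show ?thesis
      unfolding has_field_derivative_def g_eq
      by (auto intro!: derivative_eq_intros dp simp: fun_eq_iff complex_eq_iff lap' comm inner_add_left algebra_simps)
  qed
  have g0: "Re (g 0) = l\<^sup>2 + l\<^sup>2"
    using speed[OF x0] by (simp add: g_def \<gamma>_def A_def B_def p_def flip: power2_norm_eq_inner)
  have "g holomorphic_on ball 0 r"
    unfolding holomorphic_on_def field_differentiable_def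
    using derg has_field_derivative_at_within by blast
  then have "exp \<circ> g holomorphic_on ball 0 r"
    by (intro holomorphic_on_compose holomorphic_on_exp)
  moreover have Re_le: "Re (g z) \<le> Re (g 0)" if z: "z \<in> ball 0 r" for z
  proof -
    have "p i (\<gamma> z) \<bullet> p j x0 \<le> l\<^sup>2" for i j
      using norm_cauchy_schwarz[of "p i (\<gamma> z)" "p j x0"] speed[OF \<gamma>B[OF z]] speed[OF x0]
      by (simp add: p_def power2_eq_square)
    from this[of 1 1] this[of 2 2] show ?thesis unfolding g0 by (simp add: g_def A_def B_def)
  qed
  ultimately have "(exp \<circ> g) constant_on ball 0 r"
    using r by (intro maximum_modulus_principle[of _ "ball 0 r" "ball 0 r" 0]) auto
  then have Re_eq: "Re (g z) = Re (g 0)" if "z \<in> ball 0 r" for z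
  proof -
    have "exp (g z) = exp (g 0)"
      using \<open>(exp \<circ> g) constant_on ball 0 r\<close> that r unfolding constant_on_def comp_def
      by (metis centre_in_ball)
    then have "norm (exp (g z)) = norm (exp (g 0))" by simp
    then show ?thesis by simp
  qed
  define z where "z = Complex ((x - x0) $ 1) ((x - x0) $ 2)"
  have xz: "\<gamma> z = x" by (simp add: \<gamma>_def z_def vec_eq_iff forall_2 axis_def)
  have zB: "z \<in> ball 0 r"
    using x by (simp add: z_def dist_norm norm_vec_def L2_set_def sum_2 cmod_def power2_commute)
  have sum: "p 1 x \<bullet> p 1 x0 + p 2 x \<bullet> p 2 x0 = l\<^sup>2 + l\<^sup>2"
    using Re_eq[OF zB] unfolding g0 by (simp add: g_def xz A_def B_def)
  have "(norm (p i x - p i x0))\<^sup>2 = 2 * l\<^sup>2 - 2 * (p i x \<bullet> p i x0)" for i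
  proof -
    have "(norm (p i x - p i x0))\<^sup>2 = (norm (p i x))\<^sup>2 + (norm (p i x0))\<^sup>2 - 2 * (p i x \<bullet> p i x0)"
      unfolding power2_norm_eq_inner
      by (simp add: inner_diff_left inner_diff_right inner_commute[of "p i x0" "p i x"])
    then show ?thesis by (simp add: p_def speed[OF x] speed[OF x0])
  qed
  from this[of 1] this[of 2] sum
  have "(norm (p 1 x - p 1 x0))\<^sup>2 + (norm (p 2 x - p 2 x0))\<^sup>2 = 0" by simp
  then have "p 1 x = p 1 x0 \<and> p 2 x = p 2 x0" by (simp add: sum_power2_eq_zero_iff)
  then show ?thesis using exhaust_2[of i] by (auto simp: p_def)
qed

lemma constant_gradient_imp_affine:
  fixes u :: "real^2 \<Rightarrow> real^3"
  assumes C1: "C1_on (ball x0 r) u" and const: "\<And>x i. x \<in> ball x0 r \<Longrightarrow> pd i u x = pd i u x0"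
    and x: "x \<in> ball x0 r"
  shows "u x = u x0 + grad u x0 *v (x - x0)"
proof -
  let ?f = "\<lambda>x. u x - grad u x0 *v x"
  have x0: "x0 \<in> ball x0 r" using x by (auto intro: le_less_trans[OF zero_le_dist])
  have "(?f has_derivative (\<lambda>h. 0)) (at y within ball x0 r)" if y: "y \<in> ball x0 r" for y
  proof -
    have "(?f has_derivative (\<lambda>h. (\<Sum>i\<in>UNIV. (h $ i) *\<^sub>R pd i u y) - grad u x0 *v h)) (at y)"
      by (intro has_derivative_diff C1_on_has_derivative[OF C1 y] bounded_linear_imp_has_derivative
          matrix_vector_mul_bounded_linear)
    then have "(?f has_derivative (\<lambda>h. 0)) (at y)" by (simp add: const[OF y] grad_mult_eq sum_2)
    then show ?thesis by (rule has_derivative_at_withinI)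
  qed
  then obtain c where "\<forall>y\<in>ball x0 r. ?f y = c"
    using has_derivative_zero_constant[of "ball x0 r" ?f] by blast
  then have "?f x = ?f x0" using x x0 by metis
  then show ?thesis by (simp add: matrix_vector_mult_diff_distrib algebra_simps)
qed

text \<open>Near \<open>x0\<close> the parametrization is an injective affine map, so it carries non-empty open sets to
  sets that span a plane. The conclusion is phrased for all relatively open subsets so that
  planes at different points can be compared on overlaps.\<close>

lemma inf_harmonic_imp_locally_flat_chart:
  assumes u: "isothermal_param S \<Omega> u" "inf_harmonic \<Omega> u" and x0: "x0 \<in> \<Omega>"
  obtains U where "openin (top_of_set S) U" "u x0 \<in> U"
    "\<forall>U'. openin (top_of_set S) U' \<and> U' \<subseteq> U \<and> U' \<noteq> {} \<longrightarrow> aff_dim U' = 2 \<and> affine hull U' = affine hull U"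
proof -
  note lp = isothermal_paramD(1)[OF u(1)]
  obtain r where r: "r > 0" "ball x0 r \<subseteq> \<Omega>" using local_paramD(1)[OF lp] x0 openE by blast
  let ?B = "ball x0 r"
  have h: "tang_op u x + norm_op u x = 0" if "x \<in> \<Omega>" for x using u(2) that by (simp add: inf_harmonic_def)
  have tang: "tang_op u x = 0" if "x \<in> \<Omega>" for x
    using inf_harmonic_splits(1)[OF local_paramD(4)[OF lp that] h[OF that]] .
  have lpB: "local_param S ?B u" by (rule local_param_restrict[OF lp open_ball r(2)])
  have "norm (pd i u x) = norm (pd 1 u x0)" if "x \<in> ?B" for i x
  proof -
    have "pd i u x \<bullet> pd i u x = pd 1 u x0 \<bullet> pd 1 u x0"
      using conformal_factor_constant[OF u(1) r(2) that tang] isothermal_paramD(3)[OF u(1), of x] that r(2) exhaust_2[of i]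
      by auto
    then show ?thesis by (simp add: norm_eq)
  qed
  moreover have "laplacian u x = 0" if "x \<in> ?B" for x
    using inf_harmonic_isothermal_imp_laplacian_0[OF u(1), of x] h that r(2) by blast
  ultimately have "pd i u x = pd i u x0" if "x \<in> ?B" for i x
    using harmonic_constant_speed_imp_constant_gradient[OF local_paramD(2)[OF lpB] _ _ that] by blast
  then have aff: "u x = u x0 + grad u x0 *v (x - x0)" if "x \<in> ?B" for x
    using constant_gradient_imp_affine[OF C2_on_imp_C1_on[OF local_paramD(2)[OF lpB]] _ that] by blast
  have inj: "inj ((*v) (grad u x0))"
    using lp x0 full_rank_injective[of "grad u x0"] by (simp add: local_param_def)
  have dim2: "aff_dim (u ` Q) = 2" if Q: "open Q" "Q \<subseteq> ?B" "Q \<noteq> {}" for Q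
  proof -
    have "u ` Q = (+) (u x0) ` ((*v) (grad u x0) ` ((+) (- x0) ` Q))"
      using aff Q(2) by (force simp: image_image intro!: image_cong)
    then show ?thesis
      using aff_dim_open[OF Q(1,3)] by (simp add: aff_dim_translation_eq aff_dim_translation_eq_subtract aff_dim_injective_linear_image[OF matrix_vector_mul_linear inj])
  qed
  have U: "openin (top_of_set S) (u ` ?B)" by (rule local_paramD(3)[OF lpB])
  have "aff_dim U' = 2 \<and> affine hull U' = affine hull (u ` ?B)"
    if U': "openin (top_of_set S) U'" "U' \<subseteq> u ` ?B" "U' \<noteq> {}" for U'
  proof -
    have "U' = u ` (?B \<inter> u -` U')" using U'(2) by blast
    moreover have "open (?B \<inter> u -` U')"
      by (rule local_paramD(1)[OF local_param_into_open_subset[OF lpB U'(1)]])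
    ultimately have "aff_dim U' = 2" using dim2[of "?B \<inter> u -` U'"] U'(3) by (metis image_empty inf_le1)
    moreover have "aff_dim (u ` ?B) = 2" using dim2[of ?B] r(1) by simp
    ultimately show ?thesis
      using affine_dim_equal[of "affine hull U'" "affine hull (u ` ?B)"] hull_mono[OF U'(2)] U'(3)
      by (simp add: aff_dim_affine_hull)
  qed
  then show thesis using that[of "u ` ?B"] U r(1) by (metis centre_in_ball image_eqI)
qed

text \<open>The plane spanned by the chart around a point is a locally constant function of the point: the charts of
  \<open>p\<close> and of a nearby \<open>q\<close> overlap in an open set, which spans the plane of both.\<close>

lemma flat_charts_imp_planar:
  fixes S :: "(real^3) set"
  assumes "connected S"
    and charts: "\<And>p. p \<in> S \<Longrightarrow> \<exists>U. openin (top_of_set S) U \<and> p \<in> U \<and>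
      (\<forall>U'. openin (top_of_set S) U' \<and> U' \<subseteq> U \<and> U' \<noteq> {} \<longrightarrow> aff_dim U' = 2 \<and> affine hull U' = affine hull U)"
  shows "\<exists>P. affine P \<and> aff_dim P = 2 \<and> S \<subseteq> P"
proof (cases "S = {}")
  case True
  have "aff_dim {x :: real^3. axis 1 1 \<bullet> x = 0} = 2"
    by (simp add: aff_dim_hyperplane axis_eq_0_iff)
  then show ?thesis using True affine_hyperplane by blast
next
  case False
  obtain U where U: "\<And>p. p \<in> S \<Longrightarrow> openin (top_of_set S) (U p)" "\<And>p. p \<in> S \<Longrightarrow> p \<in> U p"
    and hull: "\<And>p U'. p \<in> S \<Longrightarrow> openin (top_of_set S) U' \<Longrightarrow> U' \<subseteq> U p \<Longrightarrow> U' \<noteq> {} \<Longrightarrow>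
      aff_dim U' = 2 \<and> affine hull U' = affine hull (U p)"
    using charts by metis
  have "(\<lambda>p. affine hull (U p)) constant_on S"
  proof (rule locally_constant_imp_constant[OF assms(1)])
    fix p assume p: "p \<in> S"
    have "affine hull (U q) = affine hull (U p)" if q: "q \<in> U p" for q
    proof -
      have qS: "q \<in> S" using U(1)[OF p] q openin_imp_subset by blast
      have "openin (top_of_set S) (U p \<inter> U q)" "U p \<inter> U q \<noteq> {}"
        using U(1)[OF p] U(1)[OF qS] U(2)[OF qS] q by (auto intro: openin_Int)
      then show ?thesis using hull[OF p, of "U p \<inter> U q"] hull[OF qS, of "U p \<inter> U q"] by simp
    qed
    then show "\<exists>T. openin (top_of_set S) T \<and> p \<in> T \<and> (\<forall>x\<in>T. affine hull (U x) = affine hull (U p))"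
      using U p by blast
  qed
  then obtain P where P: "\<And>p. p \<in> S \<Longrightarrow> affine hull (U p) = P" by (auto simp: constant_on_def)
  obtain p where p: "p \<in> S" using False by blast
  have "aff_dim (U p) = 2" using hull[OF p U(1)[OF p] order_refl] U(2)[OF p] by blast
  then have "aff_dim P = 2" "affine P" using P[OF p] aff_dim_affine_hull[of "U p"] affine_affine_hull[of "U p"] by simp_all
  moreover have "S \<subseteq> P"
  proof
    fix q assume "q \<in> S"
    then show "q \<in> P" using hull_inc[OF U(2), of q affine] P[of q] by simp
  qed
  ultimately show ?thesis by blast
qed

theorem planar_iff_inf_harmonic_atlas:
  assumes "C2_surface S" "connected S"
  shows "(\<exists>P. affine P \<and> aff_dim P = 2 \<and> S \<subseteq> P) \<longleftrightarrow> has_isothermal_atlas S inf_harmonic"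
proof
  assume "\<exists>P. affine P \<and> aff_dim P = 2 \<and> S \<subseteq> P"
  then show "has_isothermal_atlas S inf_harmonic" using planar_surface_has_atlas[OF assms(1)] by blast
next
  assume atlas: "has_isothermal_atlas S inf_harmonic"
  show "\<exists>P. affine P \<and> aff_dim P = 2 \<and> S \<subseteq> P"
  proof (rule flat_charts_imp_planar[OF assms(2)])
    fix p assume "p \<in> S"
    then obtain \<Omega> u x0 where u: "isothermal_param S \<Omega> u" "inf_harmonic \<Omega> u" "x0 \<in> \<Omega>" "p = u x0"
      using atlas unfolding has_isothermal_atlas_iff by blast
    show "\<exists>U. openin (top_of_set S) U \<and> p \<in> U \<and>
      (\<forall>U'. openin (top_of_set S) U' \<and> U' \<subseteq> U \<and> U' \<noteq> {} \<longrightarrow> aff_dim U' = 2 \<and> affine hull U' = affine hull U)"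
      unfolding u(4) by (rule inf_harmonic_imp_locally_flat_chart[OF u(1-3)]) blast
  qed
qed

theorem theorem3p4:
  fixes S :: "(real^3) set"
  assumes "C2_surface S"
  shows "(minimal_surface S \<longleftrightarrow> has_isothermal_atlas S norm_inf_harmonic) \<and>
         ((\<exists>c. locally_isometric_to_plane S c) \<longleftrightarrow> has_isothermal_atlas S tang_inf_harmonic) \<and>
         (connected S \<longrightarrow>
           ((\<exists>P. affine P \<and> aff_dim P = 2 \<and> S \<subseteq> P) \<longleftrightarrow> has_isothermal_atlas S inf_harmonic))"
  using minimal_iff_normal_atlas[OF assms] locally_flat_iff_tangential_atlas[OF assms]
    planar_iff_inf_harmonic_atlas[OF assms] by blast

end
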